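(* Let $(X,d)$ be a metric space, $\mu$ a Borel probability measure on $X$ and $T\colon X\to X$ a $\mu$-preserving transformation. Suppose $\mu$ satisfies condition (A) with exponent $\delta\in(0,2)$. Let $(B_i)_{i\ge0}$ be balls in $X$ such that, for some $0<\beta<1$ and some $\gamma>1+\frac{(2-\delta)\beta}{2+\delta}$, \[ \sum_{i=0}^{n-1}\mu(B_i)\ge n^{\beta}(\log n)^{\gamma}\quad\text{for all sufficiently large } n. \] Suppose $(T,X,\mu,d)$ has polynomial decay of correlations with rate $\alpha=\frac{2/\delta+1}{\beta}-1$. Then, setting \[ \Delta_n(x)=\frac{\sum_{i=0}^{n-1}1_{B_i}(T^ix)}{\sum_{i=0}^{n-1}\mu(B_i)}, \] one has $\Delta_n(x)\to1$ as $n\to\infty$ for $\mu$-a.e. $x\in X$. Moreover, for every $\epsilon>0$, $\rho>1$ and $0<\theta<\frac{(\gamma-1)(2+\delta)}{2\beta}+\frac{\delta}{2}-1$ there exist $C>0$ and $C_\theta>0$, where $C_\theta$ does not depend on $\epsilon,\rho$, such that for all sufficiently large $n$ \[ \mu(|\Delta_n-1|>\epsilon)\le C(\log n)^{-1}(\log\log n)^{-\rho}+C_\theta(\log n)^{-\theta}. \]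
   Context: Condition (A) with exponent $\delta$ ($0<\delta<2$): there exist $C>0$ and $r_0>0$ such that for all $x_0\in X$, $0<r\le r_0$ and $0<\epsilon\le1$, $\mu(\{x: r<d(x,x_0)<r+\epsilon\})<C\epsilon^{\delta}$. Convention: if the $B_i=B(x_0,r_i)$ are nested balls with $r_i\to0$, all centered at one given point $x_0$, then this inequality is only required for that point $x_0$. Polynomial decay of correlations with rate $\alpha>0$: there is a constant $C>0$ such that for all Lipschitz functions $\varphi,\psi\colon X\to\mathbb{R}$ and all $n\ge1$, $\left|\int\varphi\circ T^n\,\psi\,d\mu-\int\varphi\,d\mu\int\psi\,d\mu\right|\le c(n)\|\varphi\|_{\mathrm{Lip}}\|\psi\|_{\mathrm{Lip}}$ with $c(n)\le Cn^{-\alpha}$, where $\|\cdot\|_{\mathrm{Lip}}$ is the usual Lipschitz norm (supremum norm plus least Lipschitz constant).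
   Formalization: The formal theorem adds that the radii of the balls B_i are at most r_0 (the radius bound in condition (A)) for all sufficiently large i; without this the statement fails, since condition (A) says nothing about larger balls. *)

theory Defs
  imports "HOL-Probability.Probability"
begin

definition preserves_measure :: "'a measure \<Rightarrow> ('a \<Rightarrow> 'a) \<Rightarrow> bool" where
  "preserves_measure M T \<longleftrightarrow> T \<in> measurable M M \<and> distr M M T = M"

(* The bound on the mass of thin annuli, required for centres in S and radii up to r0.
   S is UNIV in general, and a single point for nested balls shrinking about that point.
   Nothing is said about radii above r0, so r0 stays explicit: balls to which the condition is
   applied must have radius at most r0. *)
definition condition_A :: "'a::metric_space measure \<Rightarrow> real \<Rightarrow> real \<Rightarrow> 'a set \<Rightarrow> bool" where
  "condition_A M \<delta> r0 S \<longleftrightarrow>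
     r0 > 0 \<and>
     (\<exists>C>0. \<forall>p\<in>S. \<forall>r \<epsilon>. 0 < r \<and> r \<le> r0 \<and> 0 < \<epsilon> \<and> \<epsilon> \<le> 1 \<longrightarrow>
        measure M {x. r < dist x p \<and> dist x p < r + \<epsilon>} < C * \<epsilon> powr \<delta>)"

(* Meaningful only for bounded Lipschitz functions: otherwise Sup or Inf is taken of a set
   that is unbounded or empty. *)
definition lip_norm :: "('a::metric_space \<Rightarrow> real) \<Rightarrow> real" where
  "lip_norm \<phi> = (SUP x. \<bar>\<phi> x\<bar>) + Inf {L. lipschitz_on L UNIV \<phi>}"

(* An unbounded Lipschitz function has infinite norm, so the estimate is only a constraint
   for bounded ones; on a bounded space every Lipschitz function is bounded. *)
definition bounded_lipschitz :: "('a::metric_space \<Rightarrow> real) \<Rightarrow> bool" where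
  "bounded_lipschitz \<phi> \<longleftrightarrow> bounded (range \<phi>) \<and> (\<exists>L. lipschitz_on L UNIV \<phi>)"

definition polynomial_decay ::
    "'a::metric_space measure \<Rightarrow> ('a \<Rightarrow> 'a) \<Rightarrow> real \<Rightarrow> bool" where
  "polynomial_decay M T \<alpha> \<longleftrightarrow>
     \<alpha> > 0 \<and>
     (\<exists>C>0. \<exists>c :: nat \<Rightarrow> real.
        (\<forall>n\<ge>1. c n \<le> C * real n powr (- \<alpha>)) \<and>
        (\<forall>\<phi> \<psi>. bounded_lipschitz \<phi> \<and> bounded_lipschitz \<psi> \<longrightarrow>
           (\<forall>n\<ge>1. \<bar>(\<integral>x. \<phi> ((T ^^ n) x) * \<psi> x \<partial>M) - (\<integral>x. \<phi> x \<partial>M) * (\<integral>x. \<psi> x \<partial>M)\<bar>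
                  \<le> c n * lip_norm \<phi> * lip_norm \<psi>)))"

definition hit_ratio ::
    "'a measure \<Rightarrow> ('a \<Rightarrow> 'a) \<Rightarrow> (nat \<Rightarrow> 'a set) \<Rightarrow> nat \<Rightarrow> 'a \<Rightarrow> real" where
  "hit_ratio M T B n x =
     (\<Sum>i<n. indicator (B i) ((T ^^ i) x)) / (\<Sum>i<n. measure M (B i))"

end

theory Submission
  imports Defs "HOL-Real_Asymp.Real_Asymp"
begin

text \<open>
  Replace the indicator of \<open>B i\<close> by a Lipschitz function that is 1 on \<open>B i\<close> and vanishes at distance of
  order \<open>w i\<close> from it, where \<open>w i powr \<delta>\<close> is about \<open>1 / (i * (ln i) powr (1 + \<theta>))\<close>. By condition (A) the
  orbit falls into the thickened parts after time \<open>m\<close> with probability \<open>O((ln m) powr (- \<theta>))\<close>, so the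
  two counting functions differ by a bounded amount almost surely.

  In the variance of the smoothed counting function, pairs of times at distance at most \<open>N\<close> contribute at
  most \<open>N\<close> times the mean, and the other pairs are controlled by decay of correlations with Lipschitz
  norms of order \<open>1 / w n\<close>. With \<open>N\<close> slightly below \<open>n powr \<beta> * (ln n) powr (\<gamma> - 1)\<close> Chebyshev's
  inequality bounds the probability of a relative deviation by \<open>O((ln n) powr (- 1 - \<eta>))\<close> for some
  \<open>\<eta> > 0\<close>. This is summable along times at which the mean grows geometrically, and monotonicity of the
  counting function fills the gaps.
\<close>

section \<open>Tails of two series\<close>

lemma sum_le_by_telescoping:
  fixes a F :: "nat \<Rightarrow> real"
  assumes "\<And>i. m \<le> i \<Longrightarrow> a i \<le> F i - F (Suc i)" and "\<And>i. 0 \<le> F i"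
  shows "(\<Sum>i=m..<n. a i) \<le> F m"
proof (cases "m \<le> n")
  case True
  have "(\<Sum>i=m..<n. a i) \<le> (\<Sum>i=m..<n. F i - F (Suc i))"
    by (intro sum_mono assms(1)) auto
  also have "\<dots> = F m - F n"
    using sum_Suc_diff'[OF True, of "\<lambda>i. - F i"] by simp
  finally show ?thesis using assms(2)[of n] by simp
qed (use assms(2) in auto)

text \<open>Comparison with the integral of \<open>x powr (- a)\<close> over the half-line from
  \<open>N\<close>: \<open>F\<close> is that tail integral, and the mean value theorem bounds each
  term by a difference of \<open>F\<close>.\<close>

lemma sum_powr_tail_le:
  fixes a :: real
  assumes "1 < a" and "1 \<le> N"
  shows "(\<Sum>k=N..<n. real (Suc k) powr (- a)) \<le> real N powr (1 - a) / (a - 1)"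
proof -
  define F where "F x = x powr (1 - a) / (a - 1)" for x :: real
  have "real (Suc k) powr (- a) \<le> F (real k) - F (real (Suc k))" if "N \<le> k" for k
  proof -
    have k: "1 \<le> real k" using that assms by simp
    have "\<exists>z. real k < z \<and> z < real k + 1 \<and> 
       F (real k + 1) - F (real k) = (real k + 1 - real k) * (- (z powr (- a)))"
      proof (rule MVT2)
      fix x assume "real k \<le> x"
      then have "0 < x" using k by simp
      then show "(F has_real_derivative - (x powr (- a))) (at x)"
        unfolding F_def using assms(1)
        by (auto intro!: derivative_eq_intros simp: divide_simps) (simp add: algebra_simps)
    qed simp
    then obtain z where z: "real k < z" "z < real k + 1"
      "F (real k + 1) - F (real k) = - (z powr (- a))" by auto
    have "real (Suc k) powr (- a) \<le> z powr (- a)"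
      using z k assms(1) by (intro powr_mono2') auto
    with z show ?thesis by (simp add: add.commute)
  qed
  then have "(\<Sum>k=N..<n. real (Suc k) powr (- a)) \<le> F (real N)"
    by (intro sum_le_by_telescoping) (use assms in \<open>auto simp: F_def\<close>)
  then show ?thesis by (simp add: F_def)
qed

text \<open>The same comparison with the tail integral \<open>ln x powr (- t) / t\<close>. The shift
  by 3 keeps the logarithms in the terms above 1 from index 0 on; the term \<open>k\<close> is
  compared with the interval from \<open>k + 2\<close> to \<open>k + 3\<close>.\<close>

lemma sum_log_tail_le:
  fixes t :: real
  assumes "0 < t"
  shows "(\<Sum>k=m..<n. inverse (real k + 3) * ln (real k + 3) powr (- (1 + t))) \<le> ln (real m + 2) powr (- t) / t"
proof -
  define F where "F x = ln x powr (- t) / t" for x :: real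
  have "inverse (real k + 3) * ln (real k + 3) powr (- (1 + t)) \<le> F (real k + 2) - F (real (Suc k) + 2)" for k
  proof -
    have "\<exists>z. real k + 2 < z \<and> z < real k + 3 \<and> 
       F (real k + 3) - F (real k + 2) = (real k + 3 - (real k + 2)) * (- (inverse z * ln z powr (- (1 + t))))"
    proof (rule MVT2)
      fix x assume x: "real k + 2 \<le> x"
      then have "x > 1" by simp
      then have "0 < ln x" by simp
      show "(F has_real_derivative - (inverse x * ln x powr (- (1 + t)))) (at x)"
        unfolding F_def
      proof (rule DERIV_cong[OF DERIV_cdivide[OF DERIV_chain2[OF has_real_derivative_powr DERIV_ln]]])
        have *: "- (1 + t) = - t - 1" by simp
        show "- t * ln x powr (- t - 1) * inverse x / t = - (inverse x * ln x powr (- (1 + t)))"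
          using assms by (simp only: *) simp
      qed (use \<open>x > 1\<close> \<open>0 < ln x\<close> in auto)
    qed simp
    then obtain z where z: "real k + 2 < z" "z < real k + 3"
      "F (real k + 3) - F (real k + 2) = - (inverse z * ln z powr (- (1 + t)))" by auto
    have "inverse (real k + 3) * ln (real k + 3) powr (- (1 + t)) \<le> inverse z * ln z powr (- (1 + t))"
      using z assms by (intro mult_mono powr_mono2' le_imp_inverse_le) auto
    with z show ?thesis by (simp add: add.commute)
  qed
  then have "(\<Sum>k=m..<n. inverse (real k + 3) * ln (real k + 3) powr (- (1 + t))) \<le> F (real m + 2)"
    using sum_le_by_telescoping[of m _ "\<lambda>k. F (real k + 2)" n] assms by (auto simp: F_def)
  then show ?thesis by (simp add: F_def)
qed

section \<open>Second moments and almost sure convergence\<close>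

text \<open>Expand the square into covariances \<open>c i j\<close>. In row \<open>i\<close> at most
  \<open>2 * N + 1\<close> indices lie within distance \<open>N\<close>, and there
  \<open>c i j \<le> e i\<close> because \<open>X j \<le> 1\<close> and the means are nonnegative.
  On either side of this band the covariances are bounded by the tail of a convergent series.
  Short-range pairs thus cost a multiple of the mean, which may be far smaller than
  \<open>n\<close>.\<close>

lemma (in prob_space) variance_sum_le:
  fixes X :: "nat \<Rightarrow> 'a \<Rightarrow> real"
  assumes meas [measurable]: "\<And>i. X i \<in> borel_measurable M"
    and X: "\<And>i x. 0 \<le> X i x" "\<And>i x. X i x \<le> 1"
    and cov: "\<And>i j. i + N < j \<Longrightarrow> j < n \<Longrightarrow>
      expectation (\<lambda>x. X i x * X j x) - expectation (X i) * expectation (X j) \<le> K * real (j - i) powr (- a)"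
    and "1 < a" "1 \<le> N" "0 \<le> K"
  shows "expectation (\<lambda>x. ((\<Sum>i<n. X i x) - (\<Sum>i<n. expectation (X i)))\<^sup>2)
     \<le> (2 * real N + 1) * (\<Sum>i<n. expectation (X i)) + real n * (2 * K * (real N powr (1 - a) / (a - 1)))"
proof -
  define e where "e i = expectation (X i)" for i
  define c where "c i j = expectation (\<lambda>x. X i x * X j x) - e i * e j" for i j
  have int1: "integrable M (X i)" for i
    by (rule integrable_const_bound[of _ 1]) (use X in auto)
  have int2: "integrable M (\<lambda>x. X i x * X j x)" for i j
    by (rule integrable_const_bound[of _ 1]) (use X in \<open>auto simp: abs_mult intro!: mult_le_one\<close>)
  have e0: "0 \<le> e i" for i
    using X by (auto simp: e_def intro!: integral_nonneg)
  have "expectation (\<lambda>x. ((\<Sum>i<n. X i x) - (\<Sum>i<n. e i))\<^sup>2)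
    = expectation (\<lambda>x. \<Sum>i<n. \<Sum>j<n. X i x * X j x - e i * X j x - e j * X i x + e i * e j)"
  proof (rule Bochner_Integration.integral_cong)
    fix x
    have "((\<Sum>i<n. X i x) - (\<Sum>i<n. e i))\<^sup>2 = (\<Sum>i<n. X i x - e i) * (\<Sum>j<n. X j x - e j)"
      by (simp add: sum_subtractf power2_eq_square)
    also have "\<dots> = (\<Sum>i<n. \<Sum>j<n. (X i x - e i) * (X j x - e j))"
      by (rule sum_product)
    finally show "((\<Sum>i<n. X i x) - (\<Sum>i<n. e i))\<^sup>2 = (\<Sum>i<n. \<Sum>j<n. X i x * X j x - e i * X j x - e j * X i x + e i * e j)"
      by (simp add: algebra_simps)
  qed simp
  also have "\<dots> = (\<Sum>i<n. \<Sum>j<n. c i j)"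
    using int1 int2 by (simp add: c_def e_def prob_space algebra_simps flip: e_def)
  also have "\<dots> \<le> (\<Sum>i<n. (2 * real N + 1) * e i + 2 * K * (real N powr (1 - a) / (a - 1)))"
  proof (rule sum_mono)
    fix i assume "i \<in> {..<n}"
    then have i: "i < n" by simp
    have le_e: "c i j \<le> e i" for j
    proof -
      have "expectation (\<lambda>x. X i x * X j x) \<le> e i"
        unfolding e_def using int1 int2 X by (intro integral_mono) (auto intro: mult_left_le)
      then show ?thesis using mult_nonneg_nonneg[OF e0[of i] e0[of j]] by (simp add: c_def)
    qed
    \<comment> \<open>\<open>L\<close> holds the \<open>j\<close> with \<open>j + N < i\<close>;
      truncated subtraction makes it empty for \<open>i \<le> N\<close>.\<close>
    define L where "L = {..<i - N}"
    define Q where "Q = {j. j < n \<and> i \<le> j + N \<and> j \<le> i + N}"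
    define R where "R = {Suc (i + N)..<n}"
    have "{..<n} = L \<union> (Q \<union> R)" using i by (auto simp: L_def Q_def R_def)
    moreover have "finite L" "finite Q" "finite R" "L \<inter> (Q \<union> R) = {}" "Q \<inter> R = {}"
      by (auto simp: L_def Q_def R_def)
    ultimately have "(\<Sum>j<n. c i j) = (\<Sum>j\<in>L. c i j) + ((\<Sum>j\<in>Q. c i j) + (\<Sum>j\<in>R. c i j))"
      by (simp add: sum.union_disjoint)
    moreover have "(\<Sum>j\<in>L. c i j) \<le> K * (real N powr (1 - a) / (a - 1))"
    proof -
      have "(\<Sum>j\<in>L. c i j) \<le> (\<Sum>j\<in>L. K * real (i - j) powr (- a))"
      proof (rule sum_mono)
        fix j assume "j \<in> L"
        then show "c i j \<le> K * real (i - j) powr (- a)"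
          using cov[of j i] i by (auto simp: L_def c_def e_def mult.commute)
      qed
      also have "\<dots> = K * (\<Sum>j\<in>L. real (i - j) powr (- a))" by (simp add: sum_distrib_left)
      \<comment> \<open>With \<open>k = i - Suc j\<close> the distance \<open>i - j\<close> is
        \<open>Suc k\<close>, so distances beyond \<open>N\<close> become
        \<open>k \<ge> N\<close>.\<close>
      also have "(\<Sum>j\<in>L. real (i - j) powr (- a)) = (\<Sum>k=N..<i. real (Suc k) powr (- a))"
        by (rule sum.reindex_bij_witness[of _ "\<lambda>k. i - Suc k" "\<lambda>j. i - Suc j"])
           (auto simp: L_def Suc_diff_Suc)
      also have "K * \<dots> \<le> K * (real N powr (1 - a) / (a - 1))"
        using assms by (intro mult_left_mono sum_powr_tail_le) auto
      finally show ?thesis .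
    qed
    moreover have "(\<Sum>j\<in>R. c i j) \<le> K * (real N powr (1 - a) / (a - 1))"
    proof -
      have "(\<Sum>j\<in>R. c i j) \<le> (\<Sum>j\<in>R. K * real (j - i) powr (- a))"
      proof (rule sum_mono)
        fix j assume "j \<in> R"
        then show "c i j \<le> K * real (j - i) powr (- a)"
          using cov[of i j] i by (auto simp: R_def c_def e_def)
      qed
      also have "\<dots> = K * (\<Sum>j\<in>R. real (j - i) powr (- a))" by (simp add: sum_distrib_left)
      also have "(\<Sum>j\<in>R. real (j - i) powr (- a)) = (\<Sum>k=N..<n - Suc i. real (Suc k) powr (- a))"
        by (rule sum.reindex_bij_witness[of _ "\<lambda>k. k + Suc i" "\<lambda>j. j - Suc i"])
           (auto simp: R_def Suc_diff_Suc)
      also have "K * \<dots> \<le> K * (real N powr (1 - a) / (a - 1))"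
        using assms by (intro mult_left_mono sum_powr_tail_le) auto
      finally show ?thesis .
    qed
    moreover have "(\<Sum>j\<in>Q. c i j) \<le> (2 * real N + 1) * e i"
    proof -
      have "Q \<subseteq> {i - N..i + N}" by (auto simp: Q_def)
      then have "card Q \<le> card {i - N..i + N}" by (intro card_mono) auto
      then have Q: "real (card Q) \<le> 2 * real N + 1" by simp
      have "(\<Sum>j\<in>Q. c i j) \<le> real (card Q) * e i" by (rule sum_bounded_above) (rule le_e)
      also have "\<dots> \<le> (2 * real N + 1) * e i" using Q e0 by (intro mult_right_mono)
      finally show ?thesis .
    qed
    ultimately show "(\<Sum>j<n. c i j) \<le> (2 * real N + 1) * e i + 2 * K * (real N powr (1 - a) / (a - 1))"
      by linarith
  qed
  also have "\<dots> = (2 * real N + 1) * (\<Sum>i<n. e i) + real n * (2 * K * (real N powr (1 - a) / (a - 1)))"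
    by (simp add: sum.distrib sum_distrib_left)
  finally show ?thesis by (simp add: e_def)
qed

text \<open>Chebyshev's inequality about an arbitrary centre \<open>b\<close>: Markov's inequality
  for the squared deviation, which is integrable because it is bounded.\<close>

lemma (in prob_space) prob_sum_deviation_le:
  fixes X :: "nat \<Rightarrow> 'a \<Rightarrow> real"
  assumes [measurable]: "\<And>i. X i \<in> borel_measurable M"
    and X: "\<And>i x. 0 \<le> X i x" "\<And>i x. X i x \<le> 1" and "0 < t"
  shows "prob {x \<in> space M. t < \<bar>(\<Sum>i<n. X i x) - b\<bar>}
    \<le> expectation (\<lambda>x. ((\<Sum>i<n. X i x) - b)\<^sup>2) / t\<^sup>2"
proof -
  have bd: "\<bar>(\<Sum>i<n. X i x) - b\<bar> \<le> real n + \<bar>b\<bar>" for x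
  proof -
    have "(\<Sum>i<n. X i x) \<le> real n" using sum_bounded_above[of "{..<n}" "\<lambda>i. X i x" 1] X by simp
    moreover have "0 \<le> (\<Sum>i<n. X i x)" using X by (simp add: sum_nonneg)
    ultimately show ?thesis by linarith
  qed
  have "integrable M (\<lambda>x. ((\<Sum>i<n. X i x) - b)\<^sup>2)"
    by (rule integrable_const_bound[of _ "(real n + \<bar>b\<bar>)\<^sup>2"])
       (use bd in \<open>auto simp: abs_le_square_iff[symmetric]\<close>)
  then have "prob {x \<in> space M. t\<^sup>2 \<le> ((\<Sum>i<n. X i x) - b)\<^sup>2}
    \<le> expectation (\<lambda>x. ((\<Sum>i<n. X i x) - b)\<^sup>2) / t\<^sup>2"
    using \<open>0 < t\<close> by (intro integral_Markov_inequality_measure[where A = "{}"]) auto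
  moreover have "prob {x \<in> space M. t < \<bar>(\<Sum>i<n. X i x) - b\<bar>}
      \<le> prob {x \<in> space M. t\<^sup>2 \<le> ((\<Sum>i<n. X i x) - b)\<^sup>2}"
    using \<open>0 < t\<close> by (intro finite_measure_mono) (auto simp: abs_le_square_iff[symmetric])
  ultimately show ?thesis by linarith
qed

section \<open>From a geometric subsequence to all times\<close>

lemma tendsto_one_by_ratio_bounds:
  fixes u :: "nat \<Rightarrow> real"
  assumes "\<And>m. \<forall>\<^sub>F n in sequentially.
    (1 - 1 / (real m + 2)) / (1 + 1 / (real m + 2)) \<le> u n \<and> u n \<le> (1 + 1 / (real m + 2)) * (1 + 2 / (real m + 2))"
  shows "u \<longlonglongrightarrow> 1"
proof (rule order_tendstoI)
  fix b :: real assume "b < 1"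
  have "((\<lambda>m. (1 - 1 / (real m + 2)) / (1 + 1 / (real m + 2))) \<longlongrightarrow> 1) sequentially" by real_asymp
  from order_tendstoD(1)[OF this \<open>b < 1\<close>] obtain m where *: "b < (1 - 1 / (real m + 2)) / (1 + 1 / (real m + 2))"
    by (auto simp: eventually_sequentially)
  show "\<forall>\<^sub>F n in sequentially. b < u n" using assms[of m] by eventually_elim (use * in linarith)
next
  fix b :: real assume "1 < b"
  have "((\<lambda>m. (1 + 1 / (real m + 2)) * (1 + 2 / (real m + 2))) \<longlongrightarrow> 1) sequentially" by real_asymp
  from order_tendstoD(2)[OF this \<open>1 < b\<close>] obtain m where *: "(1 + 1 / (real m + 2)) * (1 + 2 / (real m + 2)) < b"
    by (auto simp: eventually_sequentially)
  show "\<forall>\<^sub>F n in sequentially. u n < b" using assms[of m] by eventually_elim (use * in linarith)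
qed

text \<open>Every late \<open>n\<close> lies between two consecutive times at which \<open>E\<close>
  first reaches a power of \<open>1 + e\<close>. Monotonicity traps \<open>S n\<close> between the
  values of \<open>S\<close> at these times, where \<open>S\<close> is close to \<open>E\<close>,
  while \<open>E\<close> itself changes only by a factor close to \<open>1 + e\<close> in
  between.\<close>

lemma ratio_bounds_from_geometric_subsequence:
  fixes S E :: "nat \<Rightarrow> real"
  assumes S: "mono S" and E: "mono E" "E 0 = 0" "\<And>n. E (Suc n) \<le> E n + 1" "filterlim E at_top sequentially"
    and e: "0 < e" "e < 1"
    and sub: "\<forall>\<^sub>F k in sequentially. \<bar>S (LEAST n. (1 + e) ^ k \<le> E n) - E (LEAST n. (1 + e) ^ k \<le> E n)\<bar>
       \<le> e * E (LEAST n. (1 + e) ^ k \<le> E n)"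
  shows "\<forall>\<^sub>F n in sequentially. (1 - e) / (1 + e) \<le> S n / E n \<and> S n / E n \<le> (1 + e) * (1 + 2 * e)"
proof -
  define \<nu> where "\<nu> k = (LEAST n. (1 + e) ^ k \<le> E n)" for k
  have ex: "\<exists>n. c \<le> E n" for c
    using E(4) unfolding filterlim_at_top eventually_sequentially by blast
  have \<nu>_ge: "(1 + e) ^ k \<le> E (\<nu> k)" for k
    unfolding \<nu>_def by (rule LeastI_ex) (rule ex)
  have \<nu>_iff: "\<nu> k \<le> n \<longleftrightarrow> (1 + e) ^ k \<le> E n" for k n
    using \<nu>_ge[of k] monoD[OF E(1), of "\<nu> k" n] by (auto simp: \<nu>_def intro: Least_le)
  \<comment> \<open>At the preceding time \<open>E\<close> is still below the power, and one step
    adds at most 1. The preceding time exists because \<open>E 0 = 0\<close>.\<close>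
  have \<nu>_le: "E (\<nu> k) \<le> (1 + e) ^ k + 1" for k
  proof -
    have "0 < (1 + e) ^ k" using e by simp
    then have "\<nu> k \<noteq> 0" using \<nu>_ge[of k] E(2) by (metis not_le)
    then obtain m where m: "\<nu> k = Suc m" by (cases "\<nu> k") auto
    then have "E m < (1 + e) ^ k" using \<nu>_iff[of k m] by simp
    then show ?thesis using E(3)[of m] m by simp
  qed
  obtain k0 where k0: "\<And>k. k0 \<le> k \<Longrightarrow> \<bar>S (\<nu> k) - E (\<nu> k)\<bar> \<le> e * E (\<nu> k)"
    using sub unfolding eventually_sequentially \<nu>_def by auto
  \<comment> \<open>From \<open>k1\<close> on, the overshoot 1 in \<open>\<nu>_le\<close> is at most
    \<open>e * (1 + e) ^ k\<close>; this turns a factor \<open>1 + e\<close> into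
    \<open>1 + 2 * e\<close> below.\<close>
  have "filterlim (\<lambda>k. (1 + e) ^ k) at_top sequentially"
    using e by real_asymp
  then obtain k1 where k1: "\<And>k. k1 \<le> k \<Longrightarrow> 1 / e \<le> (1 + e) ^ k"
    unfolding filterlim_at_top eventually_sequentially by meson
  define k2 where "k2 = max k0 k1"
  have "(1 - e) / (1 + e) \<le> S n / E n \<and> S n / E n \<le> (1 + e) * (1 + 2 * e)" if n: "\<nu> k2 \<le> n" for n
  proof -
    \<comment> \<open>The greatest such exponent exists because the powers are unbounded;
      \<open>b\<close> bounds the candidates. It gives
      \<open>\<nu> k \<le> n \<le> \<nu> (Suc k)\<close>.\<close>
    define k where "k = (GREATEST k. (1 + e) ^ k \<le> E n)"
    obtain b where b: "E n < (1 + e) ^ b" using real_arch_pow[of "1 + e" "E n"] e by auto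
    have bd: "\<And>y. (1 + e) ^ y \<le> E n \<Longrightarrow> y \<le> b"
    proof (rule ccontr)
      fix y assume "(1 + e) ^ y \<le> E n" "\<not> y \<le> b"
      then have "(1 + e) ^ b \<le> (1 + e) ^ y" using e by (intro power_increasing) auto
      with b \<open>(1 + e) ^ y \<le> E n\<close> show False by linarith
    qed
    have k2: "(1 + e) ^ k2 \<le> E n" using n \<nu>_iff by simp
    have k: "(1 + e) ^ k \<le> E n" unfolding k_def by (rule GreatestI_nat[where P = "\<lambda>k. (1 + e) ^ k \<le> E n", OF k2 bd])
    have "k2 \<le> k" unfolding k_def by (rule Greatest_le_nat[where P = "\<lambda>k. (1 + e) ^ k \<le> E n", OF k2 bd])
    have Suc_k: "E n < (1 + e) ^ Suc k"
      using Greatest_le_nat[where P = "\<lambda>k. (1 + e) ^ k \<le> E n", OF _ bd, of "Suc k"] unfolding k_def[symmetric]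
      by (meson not_less_eq_eq not_le order_refl)
    have "0 < (1 + e) ^ k" using e by simp
    then have En: "0 < E n" using k by linarith
    have "\<nu> k \<le> n" "n \<le> \<nu> (Suc k)" using k Suc_k \<nu>_iff[of k n] \<nu>_iff[of "Suc k" n] by auto
    then have Sn: "S (\<nu> k) \<le> S n" "S n \<le> S (\<nu> (Suc k))" using S by (auto dest: monoD)
    have "(1 - e) * E n \<le> (1 + e) * S n"
    proof -
      have "(1 - e) * E n \<le> (1 - e) * (1 + e) ^ Suc k" using Suc_k e by (intro mult_left_mono) auto
      also have "\<dots> = (1 + e) * ((1 - e) * (1 + e) ^ k)" by simp
      also have "\<dots> \<le> (1 + e) * ((1 - e) * E (\<nu> k))" using \<nu>_ge[of k] e by (intro mult_left_mono) auto
      also have "\<dots> \<le> (1 + e) * S (\<nu> k)"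
        using k0[of k] \<open>k2 \<le> k\<close> e by (intro mult_left_mono) (auto simp: k2_def algebra_simps)
      also have "\<dots> \<le> (1 + e) * S n" using Sn e by (intro mult_left_mono) auto
      finally show ?thesis .
    qed
    moreover have "S n \<le> (1 + e) * (1 + 2 * e) * E n"
    proof -
      have "1 \<le> e * (1 + e) ^ k" using k1[of k] \<open>k2 \<le> k\<close> e by (auto simp: k2_def field_simps)
      then have "(1 + e) ^ Suc k + 1 \<le> (1 + 2 * e) * (1 + e) ^ k" by (simp add: algebra_simps)
      also have "\<dots> \<le> (1 + 2 * e) * E n" using k e by (intro mult_left_mono) auto
      finally have "E (\<nu> (Suc k)) \<le> (1 + 2 * e) * E n" using \<nu>_le[of "Suc k"] by linarith
      then have "(1 + e) * E (\<nu> (Suc k)) \<le> (1 + e) * ((1 + 2 * e) * E n)" using e by (intro mult_left_mono) auto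
      moreover have "S (\<nu> (Suc k)) \<le> (1 + e) * E (\<nu> (Suc k))"
        using k0[of "Suc k"] \<open>k2 \<le> k\<close> by (auto simp: k2_def algebra_simps)
      ultimately show ?thesis using Sn by simp
    qed
    ultimately show ?thesis using En e by (simp add: field_simps)
  qed
  then show ?thesis unfolding eventually_sequentially by blast
qed

text \<open>The deviation bound is not summable over all \<open>n\<close>. At the time when the mean
  first reaches \<open>(1 + d) ^ k\<close>, however, the logarithm of the time is at least
  \<open>k * ln (1 + d)\<close>, so the probabilities are \<open>O(k powr (- (1 + t)))\<close> and
  the Borel-Cantelli lemma applies.\<close>

lemma (in prob_space) AE_sum_ratio_tendsto_1:
  fixes X :: "nat \<Rightarrow> 'a \<Rightarrow> real"
  assumes [measurable]: "\<And>i. X i \<in> borel_measurable M"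
    and X: "\<And>i x. 0 \<le> X i x" "\<And>i x. X i x \<le> 1"
    and lim: "filterlim (\<lambda>n. \<Sum>i<n. expectation (X i)) at_top sequentially"
    and "0 < t"
    and dev: "\<And>e. 0 < e \<Longrightarrow> \<exists>C. \<forall>\<^sub>F n in sequentially.
      prob {x \<in> space M. e * (\<Sum>i<n. expectation (X i)) < \<bar>(\<Sum>i<n. X i x) - (\<Sum>i<n. expectation (X i))\<bar>}
        \<le> C * ln (real n) powr (- (1 + t))"
  shows "AE x in M. (\<lambda>n. (\<Sum>i<n. X i x) / (\<Sum>i<n. expectation (X i))) \<longlonglongrightarrow> 1"
proof -
  define S where "S x n = (\<Sum>i<n. X i x)" for x n
  define E where "E n = (\<Sum>i<n. expectation (X i))" for n
  have int: "integrable M (X i)" for i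
    by (rule integrable_const_bound[of _ 1]) (use X in auto)
  have e: "0 \<le> expectation (X i)" "expectation (X i) \<le> 1" for i
    using X int by (auto intro!: integral_nonneg integral_le_const)
  have S: "mono (S x)" for x
    unfolding S_def by (rule monoI) (use X in \<open>auto intro!: sum_mono2\<close>)
  have E: "mono E" "E 0 = 0" "\<And>n. E (Suc n) \<le> E n + 1" "filterlim E at_top sequentially"
    using lim by (auto simp: E_def[abs_def] e intro!: sum_mono2 monoI)
  \<comment> \<open>This converts growth of the mean into growth of time:
    \<open>(1 + d) ^ k \<le> E (\<nu> k) \<le> \<nu> k\<close>.\<close>
  have E_le: "E n \<le> real n" for n
    unfolding E_def using sum_bounded_above[of "{..<n}" "\<lambda>i. expectation (X i)" 1] e by simp
  have sub: "AE x in M. \<forall>\<^sub>F k in sequentially. \<bar>S x (LEAST n. (1 + d) ^ k \<le> E n) - E (LEAST n. (1 + d) ^ k \<le> E n)\<bar>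
       \<le> d * E (LEAST n. (1 + d) ^ k \<le> E n)" if d: "0 < d" for d
  proof -
    define \<nu> where "\<nu> k = (LEAST n. (1 + d) ^ k \<le> E n)" for k
    define A where "A k = {x \<in> space M. d * E (\<nu> k) < \<bar>S x (\<nu> k) - E (\<nu> k)\<bar>}" for k
    have [measurable]: "A k \<in> sets M" for k unfolding A_def S_def by measurable
    have "\<exists>n. c \<le> E n" for c
      using E(4) unfolding filterlim_at_top eventually_sequentially by blast
    then have "(1 + d) ^ k \<le> E (\<nu> k)" for k
      unfolding \<nu>_def by (rule LeastI_ex)
    then have \<nu>: "(1 + d) ^ k \<le> real (\<nu> k)" for k
      using E_le[of "\<nu> k"] by (meson order_trans)
    have pow: "filterlim (\<lambda>k. (1 + d) ^ k) at_top sequentially"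
      using d by real_asymp
    then have "filterlim (\<lambda>k. real (\<nu> k)) at_top sequentially"
      by (rule filterlim_at_top_mono) (use \<nu> in auto)
    then have \<nu>_lim: "filterlim \<nu> sequentially sequentially"
      by (simp add: filterlim_sequentially_iff_filterlim_real)
    obtain C where C: "\<forall>\<^sub>F n in sequentially. prob {x \<in> space M. d * E n < \<bar>S x n - E n\<bar>} \<le> C * ln (real n) powr (- (1 + t))"
      using dev[OF d] unfolding S_def E_def by blast
    have C': "\<forall>\<^sub>F k in sequentially. prob (A k) \<le> C * ln (real (\<nu> k)) powr (- (1 + t))"
      using filterlim_iff[THEN iffD1, OF \<nu>_lim, rule_format, OF C] unfolding A_def .
    have "\<forall>\<^sub>F k in sequentially. norm (prob (A k)) \<le> \<bar>C\<bar> * ln (1 + d) powr (- (1 + t)) * real k powr (- (1 + t))"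
      using C' eventually_gt_at_top[of 0]
    proof eventually_elim
      case (elim k)
      have "0 < (1 + d) ^ k" using d by simp
      then have "ln ((1 + d) ^ k) \<le> ln (real (\<nu> k))" using \<nu>[of k] by (subst ln_le_cancel_iff) auto
      then have "real k * ln (1 + d) \<le> ln (real (\<nu> k))" using d by (simp add: ln_realpow)
      then have "ln (real (\<nu> k)) powr (- (1 + t)) \<le> (real k * ln (1 + d)) powr (- (1 + t))"
        using \<open>0 < t\<close> \<open>0 < k\<close> d by (intro powr_mono2') auto
      also have "\<dots> = ln (1 + d) powr (- (1 + t)) * real k powr (- (1 + t))"
        using d by (simp add: powr_mult mult.commute)
      finally have "\<bar>C\<bar> * ln (real (\<nu> k)) powr (- (1 + t)) \<le> \<bar>C\<bar> * (ln (1 + d) powr (- (1 + t)) * real k powr (- (1 + t)))"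
        by (intro mult_left_mono) auto
      moreover have "C * ln (real (\<nu> k)) powr (- (1 + t)) \<le> \<bar>C\<bar> * ln (real (\<nu> k)) powr (- (1 + t))"
        by (intro mult_right_mono) auto
      ultimately show ?case using elim by (simp add: mult.assoc)
    qed
    moreover have "summable (\<lambda>k. \<bar>C\<bar> * ln (1 + d) powr (- (1 + t)) * real k powr (- (1 + t)))"
      using \<open>0 < t\<close> by (intro summable_mult) (simp add: summable_real_powr_iff)
    ultimately have "summable (\<lambda>k. prob (A k))"
      by (rule summable_comparison_test_ev)
    then have "AE x in M. eventually (\<lambda>k. x \<in> space M - A k) sequentially"
      by (intro borel_cantelli_AE1) (auto simp: emeasure_eq_measure)
    then show ?thesis
    proof eventually_elim
      case (elim x)
      then show ?case by eventually_elim (auto simp: A_def \<nu>_def)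
    qed
  qed
  \<comment> \<open>Only the countably many tolerances \<open>1 / (m + 2)\<close> are used, so a
    single null set serves all of them.\<close>
  have "AE x in M. \<forall>m::nat. \<forall>\<^sub>F k in sequentially. 
    \<bar>S x (LEAST n. (1 + 1 / (real m + 2)) ^ k \<le> E n) - E (LEAST n. (1 + 1 / (real m + 2)) ^ k \<le> E n)\<bar>
       \<le> 1 / (real m + 2) * E (LEAST n. (1 + 1 / (real m + 2)) ^ k \<le> E n)"
    unfolding AE_all_countable by (intro allI sub) simp
  then show ?thesis
  proof eventually_elim
    case (elim x)
    have "(\<lambda>n. S x n / E n) \<longlonglongrightarrow> 1"
    proof (rule tendsto_one_by_ratio_bounds)
      fix m
      show "\<forall>\<^sub>F n in sequentially. (1 - 1 / (real m + 2)) / (1 + 1 / (real m + 2)) \<le> S x n / E n \<and>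
          S x n / E n \<le> (1 + 1 / (real m + 2)) * (1 + 2 / (real m + 2))"
        using ratio_bounds_from_geometric_subsequence[OF S E, of "1 / (real m + 2)"] elim by simp
    qed
    then show ?case by (simp add: S_def E_def)
  qed
qed

section \<open>Lipschitz bump functions\<close>

definition bump :: "'a::metric_space \<Rightarrow> real \<Rightarrow> real \<Rightarrow> 'a \<Rightarrow> real" where
  "bump p r h x = max 0 (min 1 (1 - (dist x p - r) / h))"

lemma bump_nonneg: "0 \<le> bump p r h x"
  and bump_le_1: "bump p r h x \<le> 1"
  by (auto simp: bump_def)

lemma bump_eq_1: "0 < h \<Longrightarrow> dist x p \<le> r \<Longrightarrow> bump p r h x = 1"
  by (auto simp: bump_def divide_nonpos_pos)

lemma bump_eq_0: "0 < h \<Longrightarrow> r + h \<le> dist x p \<Longrightarrow> bump p r h x = 0"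
  by (auto simp: bump_def field_simps)

lemma lipschitz_on_bump:
  assumes "0 < h"
  shows "(1 / h)-lipschitz_on UNIV (bump p r h)"
proof (rule lipschitz_onI)
  fix x y
  have "dist (bump p r h x) (bump p r h y) \<le> \<bar>(dist x p - r) / h - (dist y p - r) / h\<bar>"
    unfolding bump_def dist_real_def by linarith
  also have "\<dots> = \<bar>dist x p - dist y p\<bar> / h"
    using assms by (simp add: diff_divide_distrib[symmetric])
  also have "\<dots> \<le> dist x y / h"
    using assms by (intro divide_right_mono) (use dist_triangle2[of x p y] dist_triangle2[of y p x] in \<open>auto simp: dist_commute abs_le_iff algebra_simps\<close>)
  finally show "dist (bump p r h x) (bump p r h y) \<le> 1 / h * dist x y" by simp
qed (use assms in simp)

lemma bounded_lipschitz_bump: "0 < h \<Longrightarrow> bounded_lipschitz (bump p r h)"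
  unfolding bounded_lipschitz_def
  by (auto intro!: lipschitz_on_bump boundedI[of _ 1] simp: bump_nonneg bump_le_1)

text \<open>Boundedness makes the supremum a genuine one, and a Lipschitz constant makes the set
  under \<open>Inf\<close> nonempty; otherwise the two values would be arbitrary.\<close>

lemma lip_norm_nonneg:
  assumes "bounded_lipschitz \<phi>"
  shows "0 \<le> lip_norm \<phi>"
proof -
  obtain b where "\<bar>\<phi> x\<bar> \<le> b" for x
    using assms by (auto simp: bounded_lipschitz_def bounded_iff)
  then have "bdd_above (range (\<lambda>x. \<bar>\<phi> x\<bar>))" by (intro bdd_aboveI[of _ b]) auto
  then have "0 \<le> (SUP x. \<bar>\<phi> x\<bar>)"
    by (intro cSUP_upper2[where x = undefined]) auto
  moreover have "0 \<le> Inf {L. L-lipschitz_on UNIV \<phi>}"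
    using assms by (intro cInf_greatest) (auto simp: bounded_lipschitz_def dest: lipschitz_on_nonneg)
  ultimately show ?thesis by (simp add: lip_norm_def)
qed

lemma lip_norm_bump_le:
  assumes "0 < h"
  shows "lip_norm (bump p r h) \<le> 1 + 1 / h"
proof -
  have "(SUP x. \<bar>bump p r h x\<bar>) \<le> 1"
    by (intro cSUP_least) (auto simp: bump_nonneg bump_le_1)
  moreover have "Inf {L. L-lipschitz_on UNIV (bump p r h)} \<le> 1 / h"
    using lipschitz_on_bump[OF assms, of p r]
    by (intro cInf_lower bdd_belowI[of _ 0]) (auto dest: lipschitz_on_nonneg)
  ultimately show ?thesis by (simp add: lip_norm_def)
qed

lemma preserves_measure_funpow:
  assumes "preserves_measure M T"
  shows "preserves_measure M (T ^^ i)"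
proof (induction i)
  case 0
  show ?case by (simp add: preserves_measure_def id_def distr_id2)
next
  case (Suc i)
  have [measurable]: "T \<in> measurable M M" "T ^^ i \<in> measurable M M"
    using assms Suc by (auto simp: preserves_measure_def)
  have "distr M M (\<lambda>x. T ((T ^^ i) x)) = distr (distr M M (T ^^ i)) M T"
    by (simp add: distr_distr comp_def)
  then show ?case using assms Suc by (simp add: preserves_measure_def comp_def)
qed

section \<open>Thickened targets\<close>

text \<open>The constants \<open>K\<close>, \<open>D\<close> and \<open>i0\<close> are parameters,
  so that they can be chosen before \<theta>; the dependence of the final bounds on \<theta> then
  stays explicit. Radii are at most \<open>r0\<close> only from \<open>i0\<close> on, hence the
  annulus bound is applied only to those targets.\<close>

locale thickened_targets = prob_space M for M :: "'a::metric_space measure" +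
  fixes T :: "'a \<Rightarrow> 'a" and p :: "nat \<Rightarrow> 'a" and r :: "nat \<Rightarrow> real"
    and r0 K D \<delta> \<theta> \<alpha> :: real and i0 :: nat
  assumes sets_M: "sets M = sets borel"
    and T: "preserves_measure M T"
    and \<delta>: "0 < \<delta>" and \<theta>: "0 < \<theta>" and \<alpha>: "1 < \<alpha>" and D: "0 \<le> D" and K: "0 \<le> K"
    and r_pos: "0 < r i" and r_le: "i0 \<le> i \<Longrightarrow> r i \<le> r0"
    and annulus: "\<And>i s e. 0 < s \<Longrightarrow> s \<le> r0 \<Longrightarrow> 0 < e \<Longrightarrow> e \<le> 1 \<Longrightarrow>
      prob {x. s < dist x (p i) \<and> dist x (p i) < s + e} \<le> K * e powr \<delta>"
    and decay: "\<And>\<phi> \<psi> n. bounded_lipschitz \<phi> \<Longrightarrow> bounded_lipschitz \<psi> \<Longrightarrow> 1 \<le> n \<Longrightarrow>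
      \<bar>expectation (\<lambda>x. \<phi> ((T ^^ n) x) * \<psi> x) - expectation \<phi> * expectation \<psi>\<bar>
        \<le> D * real n powr (- \<alpha>) * lip_norm \<phi> * lip_norm \<psi>"
begin

text \<open>The widths are chosen so that the thickened parts have summable measure with tails of order
  \<open>(ln n) powr (- \<theta>)\<close>.\<close>

definition width :: "nat \<Rightarrow> real" where
  "width i = (real i + 3) powr (- (1 / \<delta>)) * ln (real i + 3) powr (- ((1 + \<theta>) / \<delta>))"

text \<open>The transition layer takes only half of \<open>width i\<close>; the other half leaves
  room for an annulus whose inner radius is less than \<open>r i\<close>.\<close>

definition smooth_hit :: "nat \<Rightarrow> 'a \<Rightarrow> real" where
  "smooth_hit i x = bump (p i) (r i) (width i / 2) ((T ^^ i) x)"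

definition hit :: "nat \<Rightarrow> 'a set" where
  "hit i = {x \<in> space M. (T ^^ i) x \<in> ball (p i) (r i)}"

definition near_miss :: "nat \<Rightarrow> 'a set" where
  "near_miss i = {x \<in> space M. r i \<le> dist ((T ^^ i) x) (p i) \<and> dist ((T ^^ i) x) (p i) < r i + width i / 2}"

lemma space_M: "space M = UNIV"
  using sets_M sets_eq_imp_space_eq by fastforce

lemma measurable_funpow_T [measurable]: "T ^^ i \<in> measurable M M"
  and distr_funpow_T: "distr M M (T ^^ i) = M"
  using preserves_measure_funpow[OF T] by (auto simp: preserves_measure_def)

lemma measurable_borel_M: "f \<in> borel_measurable borel \<Longrightarrow> f \<in> borel_measurable M"
  using measurable_cong_sets[OF sets_M refl] by blast

lemma measurable_dist [measurable]: "(\<lambda>x. dist x q) \<in> borel_measurable M"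
  by (intro measurable_borel_M borel_measurable_continuous_onI continuous_intros)

lemma measurable_bump [measurable]: "bump q s h \<in> borel_measurable M"
  unfolding bump_def by measurable

lemma measurable_smooth_hit [measurable]: "smooth_hit i \<in> borel_measurable M"
  unfolding smooth_hit_def by measurable

lemma sets_hit [measurable]: "hit i \<in> sets M"
  unfolding hit_def mem_ball dist_commute[of "p i"] by measurable

lemma sets_near_miss [measurable]: "near_miss i \<in> sets M"
  unfolding near_miss_def by measurable

lemma expectation_funpow:
  fixes g :: "'a \<Rightarrow> real"
  shows "g \<in> borel_measurable M \<Longrightarrow> expectation (\<lambda>x. g ((T ^^ i) x)) = expectation g"
  using integral_distr[of "T ^^ i" M M g] by (simp add: distr_funpow_T)

lemma prob_funpow:
  assumes "A \<in> sets M"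
  shows "prob {x \<in> space M. (T ^^ i) x \<in> A} = prob A"
  using measure_distr[of "T ^^ i" M M A] assms
  by (simp add: distr_funpow_T vimage_def Int_def conj_commute)

section \<open>Elementary bounds for widths and smoothed hits\<close>

lemma ln_ge_1: "1 \<le> ln (real i + 3)"
proof -
  have "exp 1 \<le> real i + 3" using exp_le by linarith
  then show ?thesis by (subst ln_ge_iff) auto
qed

lemma width_pos: "0 < width i"
  using ln_ge_1[of i] unfolding width_def by (intro mult_pos_pos) auto

lemma width_powr: "width i powr \<delta> = inverse (real i + 3) * ln (real i + 3) powr (- (1 + \<theta>))"
  using ln_ge_1[of i] \<delta> by (simp add: width_def powr_mult powr_powr powr_neg_one inverse_eq_divide)

lemma width_antimono: "i \<le> n \<Longrightarrow> width n \<le> width i"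
  unfolding width_def using ln_ge_1[of i] \<delta> \<theta> by (intro mult_mono powr_mono2') auto

lemma width_le_1: "width i \<le> 1"
proof -
  have "(real i + 3) powr (- (1 / \<delta>)) \<le> (real i + 3) powr 0"
    using \<delta> by (intro powr_mono) auto
  moreover have "ln (real i + 3) powr (- ((1 + \<theta>) / \<delta>)) \<le> ln (real i + 3) powr 0"
    using \<delta> \<theta> ln_ge_1[of i] by (intro powr_mono) auto
  ultimately show ?thesis using ln_ge_1[of i] unfolding width_def by (intro mult_le_one) auto
qed

lemma smooth_hit_nonneg: "0 \<le> smooth_hit i x"
  and smooth_hit_le_1: "smooth_hit i x \<le> 1"
  by (auto simp: smooth_hit_def bump_nonneg bump_le_1)

lemma integrable_smooth_hit: "integrable M (smooth_hit i)"
  by (rule integrable_const_bound[of _ 1]) (auto simp: smooth_hit_nonneg smooth_hit_le_1)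

lemma indicator_hit_le: "indicator (hit i) x \<le> smooth_hit i x"
  using width_pos[of i] 
  by (auto simp: indicator_def hit_def smooth_hit_def bump_nonneg bump_eq_1 dist_commute)

lemma smooth_hit_le: "smooth_hit i x \<le> indicator (hit i) x + indicator (near_miss i) x"
proof (cases "x \<in> hit i \<or> x \<in> near_miss i")
  case True
  then show ?thesis using smooth_hit_le_1[of i x] by (auto simp: indicator_def)
next
  case False
  then have "smooth_hit i x = 0"
    unfolding smooth_hit_def using width_pos[of i]
    by (intro bump_eq_0) (auto simp: hit_def near_miss_def space_M dist_commute)
  then show ?thesis by simp
qed

text \<open>The sphere of radius \<open>r i\<close> lies in no annulus starting at \<open>r i\<close>, so the inner radius is
  decreased a little.\<close>

lemma prob_near_miss_le:
  assumes "i0 \<le> i"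
  shows "prob (near_miss i) \<le> K * (inverse (real i + 3) * ln (real i + 3) powr (- (1 + \<theta>)))"
proof -
  \<comment> \<open>The first entry of the minimum keeps \<open>s\<close> positive; the second
    ensures that an annulus of width \<open>width i\<close> starting at \<open>s\<close> still
    covers the layer up to \<open>r i + width i / 2\<close>.\<close>
  define s where "s = r i - min (r i / 2) (width i / 2)"
  define A where "A = {x \<in> space M. r i \<le> dist x (p i) \<and> dist x (p i) < r i + width i / 2}"
  have [measurable]: "A \<in> sets M" unfolding A_def by measurable
  have s: "0 < s" "s < r i" "r i + width i / 2 \<le> s + width i"
    using r_pos[of i] width_pos[of i] by (auto simp: s_def)
  have "near_miss i = {x \<in> space M. (T ^^ i) x \<in> A}"
    by (auto simp: near_miss_def A_def space_M)
  then have "prob (near_miss i) = prob A" by (simp add: prob_funpow)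
  also have "\<dots> \<le> prob {x \<in> space M. s < dist x (p i) \<and> dist x (p i) < s + width i}"
    using s by (intro finite_measure_mono) (auto simp: A_def)
  also have "\<dots> \<le> K * width i powr \<delta>"
    using annulus[of s "width i" i] s r_le[OF assms] width_pos[of i] width_le_1[of i] by (simp add: space_M)
  finally show ?thesis by (simp add: width_powr)
qed

lemma sum_prob_near_miss_le:
  assumes "i0 \<le> m"
  shows "(\<Sum>i=m..<n. prob (near_miss i)) \<le> K / \<theta> * ln (real m + 2) powr (- \<theta>)"
proof -
  have "(\<Sum>i=m..<n. prob (near_miss i)) \<le> (\<Sum>i=m..<n. K * (inverse (real i + 3) * ln (real i + 3) powr (- (1 + \<theta>))))"
    using assms by (intro sum_mono prob_near_miss_le) auto
  also have "\<dots> = K * (\<Sum>i=m..<n. inverse (real i + 3) * ln (real i + 3) powr (- (1 + \<theta>)))"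
    by (simp add: sum_distrib_left)
  also have "\<dots> \<le> K * (ln (real m + 2) powr (- \<theta>) / \<theta>)"
    using K \<theta> by (intro mult_left_mono sum_log_tail_le)
  finally show ?thesis by simp
qed

lemma AE_finitely_many_near_misses: "AE x in M. \<forall>\<^sub>F i in sequentially. x \<notin> near_miss i"
proof -
  have "summable (\<lambda>i. prob (near_miss (i + i0)))"
  proof (rule summableI_nonneg_bounded)
    fix n
    show "(\<Sum>i<n. prob (near_miss (i + i0))) \<le> K / \<theta> * ln (real i0 + 2) powr (- \<theta>)"
      using sum_prob_near_miss_le[of i0 "n + i0"] sum.shift_bounds_nat_ivl[of "\<lambda>i. prob (near_miss i)" 0 i0 n]
      by (simp add: atLeast0LessThan)
  qed simp
  then have "summable (\<lambda>i. prob (near_miss i))" by (rule summable_iff_shift[THEN iffD1])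
  then have "AE x in M. \<forall>\<^sub>F i in sequentially. x \<in> space M - near_miss i"
    by (intro borel_cantelli_AE1) (auto simp: emeasure_eq_measure)
  then show ?thesis by eventually_elim (auto elim: eventually_mono)
qed

text \<open>Invariance under \<open>T ^^ i\<close> moves the pair to the times 0 and
  \<open>j - i\<close>, where decay of correlations applies. The factor 9 is the square of 3: a bump
  has norm at most \<open>1 + 2 / width i \<le> 3 / width i\<close>, and the widths
  decrease.\<close>

lemma smooth_hit_correlation_le:
  assumes "i < j" "j < n"
  shows "expectation (\<lambda>x. smooth_hit i x * smooth_hit j x) - expectation (smooth_hit i) * expectation (smooth_hit j)
    \<le> 9 * D / (width n)\<^sup>2 * real (j - i) powr (- \<alpha>)"
proof -
  define f where "f i = bump (p i) (r i) (width i / 2)" for i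
  have [measurable]: "f i \<in> borel_measurable M" for i by (simp add: f_def)
  have f: "bounded_lipschitz (f i)" for i
    unfolding f_def using width_pos[of i] by (intro bounded_lipschitz_bump) simp
  have lip: "lip_norm (f i) \<le> 3 / width n" if "i < n" for i
  proof -
    have "lip_norm (f i) \<le> 1 + 2 / width i"
      unfolding f_def using lip_norm_bump_le[of "width i / 2" "p i" "r i"] width_pos[of i] by simp
    also have "\<dots> \<le> 3 / width i" using width_pos[of i] width_le_1[of i] by (simp add: field_simps)
    also have "\<dots> \<le> 3 / width n"
      using width_antimono[of i n] width_pos that by (intro divide_left_mono) auto
    finally show ?thesis .
  qed
  have "smooth_hit i x * smooth_hit j x = f j ((T ^^ (j - i)) ((T ^^ i) x)) * f i ((T ^^ i) x)" for x
    using assms funpow_add[of "j - i" i T] by (simp add: smooth_hit_def f_def)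
  then have "expectation (\<lambda>x. smooth_hit i x * smooth_hit j x) = expectation (\<lambda>y. f j ((T ^^ (j - i)) y) * f i y)"
    using expectation_funpow[of "\<lambda>y. f j ((T ^^ (j - i)) y) * f i y" i] by simp
  moreover have "expectation (smooth_hit k) = expectation (f k)" for k
    unfolding smooth_hit_def f_def by (rule expectation_funpow) measurable
  ultimately have "expectation (\<lambda>x. smooth_hit i x * smooth_hit j x) - expectation (smooth_hit i) * expectation (smooth_hit j)
    \<le> D * real (j - i) powr (- \<alpha>) * lip_norm (f j) * lip_norm (f i)"
    using decay[OF f f, of "j - i" j i] assms by (simp add: mult.commute Suc_le_eq)
  also have "\<dots> \<le> D * real (j - i) powr (- \<alpha>) * (3 / width n) * (3 / width n)"
    using D assms width_pos[of n] by (intro mult_mono lip mult_nonneg_nonneg lip_norm_nonneg f) auto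
  also have "\<dots> = 9 * D / (width n)\<^sup>2 * real (j - i) powr (- \<alpha>)"
    by (simp add: power2_eq_square)
  finally show ?thesis .
qed

text \<open>The Chebyshev and variance bounds combined. The cut-off \<open>N\<close> is left free,
  to be balanced against the growing Lipschitz norms later.\<close>

lemma prob_smooth_deviation_le:
  assumes "1 \<le> N" "0 < t"
  shows "prob {x \<in> space M. t < \<bar>(\<Sum>i<n. smooth_hit i x) - (\<Sum>i<n. expectation (smooth_hit i))\<bar>}
    \<le> ((2 * real N + 1) * (\<Sum>i<n. expectation (smooth_hit i))
        + real n * (2 * (9 * D / (width n)\<^sup>2) * (real N powr (1 - \<alpha>) / (\<alpha> - 1)))) / t\<^sup>2"
proof -
  have "expectation (\<lambda>x. ((\<Sum>i<n. smooth_hit i x) - (\<Sum>i<n. expectation (smooth_hit i)))\<^sup>2)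
    \<le> (2 * real N + 1) * (\<Sum>i<n. expectation (smooth_hit i))
        + real n * (2 * (9 * D / (width n)\<^sup>2) * (real N powr (1 - \<alpha>) / (\<alpha> - 1)))"
    using assms \<alpha> D smooth_hit_correlation_le
    by (intro variance_sum_le) (auto simp: smooth_hit_nonneg smooth_hit_le_1)
  then have "expectation (\<lambda>x. ((\<Sum>i<n. smooth_hit i x) - (\<Sum>i<n. expectation (smooth_hit i)))\<^sup>2) / t\<^sup>2
    \<le> ((2 * real N + 1) * (\<Sum>i<n. expectation (smooth_hit i))
        + real n * (2 * (9 * D / (width n)\<^sup>2) * (real N powr (1 - \<alpha>) / (\<alpha> - 1)))) / t\<^sup>2"
    by (intro divide_right_mono) auto
  with prob_sum_deviation_le[of smooth_hit t n] assms show ?thesis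
    by (meson measurable_smooth_hit order_trans smooth_hit_le_1 smooth_hit_nonneg)
qed

section \<open>Comparison of hits with smoothed hits\<close>

lemma prob_hit: "prob (hit i) = prob (ball (p i) (r i))"
  unfolding hit_def by (rule prob_funpow) (simp add: sets_M)

lemma expectation_smooth_hit_ge: "prob (hit i) \<le> expectation (smooth_hit i)"
proof -
  have "expectation (indicator (hit i)) \<le> expectation (smooth_hit i)"
    by (intro integral_mono integrable_smooth_hit indicator_hit_le) (simp add: emeasure_eq_measure)
  then show ?thesis by simp
qed

lemma expectation_smooth_hit_le: "expectation (smooth_hit i) \<le> prob (hit i) + prob (near_miss i)"
proof -
  have "expectation (smooth_hit i) \<le> expectation (\<lambda>x. indicator (hit i) x + indicator (near_miss i) x)"
    by (intro integral_mono integrable_smooth_hit smooth_hit_le) (simp add: emeasure_eq_measure)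
  then show ?thesis by (simp add: emeasure_eq_measure)
qed

text \<open>The means differ by at most the total measure of the near misses, which is finite:
  finitely many terms before \<open>i0\<close>, and a convergent series after it.\<close>

lemma sum_expectation_smooth_hit_le:
  "\<exists>c. \<forall>n. (\<Sum>i<n. expectation (smooth_hit i)) \<le> (\<Sum>i<n. prob (hit i)) + c"
proof (intro exI allI)
  fix n
  have "(\<Sum>i<n. prob (near_miss i)) \<le> (\<Sum>i\<in>{..<i0} \<union> {i0..<n}. prob (near_miss i))"
    by (intro sum_mono2) auto
  also have "\<dots> = (\<Sum>i<i0. prob (near_miss i)) + (\<Sum>i=i0..<n. prob (near_miss i))"
    by (intro sum.union_disjoint) auto
  also have "\<dots> \<le> (\<Sum>i<i0. prob (near_miss i)) + K / \<theta> * ln (real i0 + 2) powr (- \<theta>)"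
    using sum_prob_near_miss_le[of i0 n] by simp
  finally show "(\<Sum>i<n. expectation (smooth_hit i)) \<le> (\<Sum>i<n. prob (hit i)) + 
      ((\<Sum>i<i0. prob (near_miss i)) + K / \<theta> * ln (real i0 + 2) powr (- \<theta>))"
    using sum_mono[of "{..<n}" "\<lambda>i. expectation (smooth_hit i)" "\<lambda>i. prob (hit i) + prob (near_miss i)",
        OF expectation_smooth_hit_le] by (simp add: sum.distrib)
qed

text \<open>All near misses occur before time \<open>m\<close>, and each adds at most 1 to the
  smoothed count.\<close>

lemma sum_smooth_hit_le:
  assumes "\<And>i. m \<le> i \<Longrightarrow> i < n \<Longrightarrow> x \<notin> near_miss i"
  shows "(\<Sum>i<n. smooth_hit i x) \<le> (\<Sum>i<n. indicator (hit i) x) + real m"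
proof -
  have "(\<Sum>i<n. indicator (near_miss i) x) \<le> (\<Sum>i<n. if i < m then 1 else 0 :: real)"
    using assms by (intro sum_mono) (auto simp: indicator_def)
  also have "\<dots> = real (card ({..<n} \<inter> {..<m}))"
    by (simp add: sum.If_cases lessThan_def)
  also have "\<dots> \<le> real (card {..<m})" by (intro of_nat_mono card_mono) auto
  finally have "(\<Sum>i<n. indicator (near_miss i) x) \<le> real m" by simp
  then show ?thesis
    using sum_mono[of "{..<n}", of "\<lambda>i. smooth_hit i x" "\<lambda>i. indicator (hit i) x + indicator (near_miss i) x", OF smooth_hit_le] by (simp add: sum.distrib)
qed

end

section \<open>Relative deviations of the counting function\<close>

lemma filterlim_at_top_of_powr_ln_le:
  fixes f :: "nat \<Rightarrow> real"
  assumes "\<forall>\<^sub>F n in sequentially. real n powr b * ln (real n) powr g \<le> f n" and "0 < b"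
  shows "filterlim f at_top sequentially"
proof (rule filterlim_at_top_mono[OF _ assms(1)])
  show "filterlim (\<lambda>n. real n powr b * ln (real n) powr g) at_top sequentially"
    using assms(2) by real_asymp
qed

lemma tendsto_bounded_divide_at_top:
  fixes u E :: "nat \<Rightarrow> real"
  assumes "\<And>n. \<bar>u n\<bar> \<le> c" "filterlim E at_top sequentially"
  shows "(\<lambda>n. u n / E n) \<longlonglongrightarrow> 0"
proof (rule Lim_null_comparison)
  show "\<forall>\<^sub>F n in sequentially. norm (u n / E n) \<le> c / E n"
    using filterlim_at_top_dense[THEN iffD1, OF assms(2), rule_format, of 0]
    by eventually_elim (use assms(1) in \<open>auto simp: divide_simps\<close>)
  show "(\<lambda>n. c / E n) \<longlonglongrightarrow> 0"
    using assms(2) by (intro tendsto_divide_0[OF tendsto_const] filterlim_at_top_imp_at_infinity)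
qed

text \<open>The left side is the normalized contribution of long time differences, up to constants:
  \<open>n\<close> rows, the tail beyond the cut-off, two Lipschitz norms, and the squared mean
  below. In exponential form it is a linear identity between exponents.\<close>

lemma powr_balance:
  fixes x L :: real
  assumes "0 < x" "0 < L"
  shows "x * ((x powr \<beta> * L powr \<kappa>) powr (1 - \<alpha>)) * (x powr a * L powr b)\<^sup>2 / (x powr \<beta> * L powr \<gamma>)\<^sup>2
    = x powr (1 + 2 * a - \<beta> * (1 + \<alpha>)) * L powr (\<kappa> * (1 - \<alpha>) + 2 * b - 2 * \<gamma>)"
proof -
  obtain u v where "x = exp u" "L = exp v" using assms by (metis exp_ln)
  then show ?thesis
    by (simp add: powr_def ln_mult power2_eq_square exp_add[symmetric] exp_diff[symmetric] algebra_simps)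
qed

text \<open>The cut-off between short and long time differences is \<open>n powr \<beta> * (ln n) powr \<kappa>\<close> with
  \<open>\<kappa> = \<gamma> - 1 - \<eta>\<close>. Short differences then contribute \<open>(ln n) powr (- 1 - \<eta>)\<close> to the normalized variance;
  the rate \<open>\<alpha>\<close> makes the powers of \<open>n\<close> cancel in the contribution of the long ones, and the bound on
  \<open>\<theta>\<close> leaves room for \<open>\<eta> > 0\<close> in the exponent of \<open>ln n\<close>.\<close>

lemma (in thickened_targets) prob_relative_deviation_le:
  assumes \<beta>: "0 < \<beta>"
    and \<alpha>_eq: "\<alpha> = (2 / \<delta> + 1) / \<beta> - 1"
    and \<theta>_less: "\<theta> < (\<gamma> - 1) * (2 + \<delta>) / (2 * \<beta>) + \<delta> / 2 - 1"
    and E: "\<forall>\<^sub>F n in sequentially. real n powr \<beta> * ln (real n) powr \<gamma> \<le> (\<Sum>i<n. expectation (smooth_hit i))"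
  shows "\<exists>\<eta>>0. \<forall>e>0. \<exists>C. \<forall>\<^sub>F n in sequentially.
    prob {x \<in> space M. e * (\<Sum>i<n. expectation (smooth_hit i))
        < \<bar>(\<Sum>i<n. smooth_hit i x) - (\<Sum>i<n. expectation (smooth_hit i))\<bar>}
      \<le> C * ln (real n) powr (- (1 + \<eta>))"
proof -
  \<comment> \<open>\<open>g\<close> is the slack in the bound on \<theta>, and \<eta> is
    \<open>g\<close> rescaled so that \<open>\<kappa> * (1 + \<alpha>) = 2 * b - 1\<close>. With
    \<open>\<kappa> = \<gamma> - 1 - \<eta>\<close>, the exponent of \<open>ln n\<close> for long
    differences then becomes \<open>- 1 - 2 * \<eta>\<close>.\<close>
  define g where "g = (\<gamma> - 1) * (2 + \<delta>) / (2 * \<beta>) + \<delta> / 2 - 1 - \<theta>"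
  define \<eta> where "\<eta> = g * (2 * \<beta>) / (2 + \<delta>)"
  define \<kappa> where "\<kappa> = \<gamma> - 1 - \<eta>"
  define a where "a = 1 / \<delta>"
  define b where "b = (1 + \<theta>) / \<delta>"
  have g: "0 < g" using \<theta>_less by (simp add: g_def)
  then have \<eta>: "0 < \<eta>" using \<beta> \<delta> by (simp add: \<eta>_def)
  have n_exp: "1 + 2 * a - \<beta> * (1 + \<alpha>) = 0"
    using \<beta> \<delta> by (simp add: \<alpha>_eq a_def)
  have "\<kappa> * (1 + \<alpha>) = 2 * b - 1"
  proof -
    have "\<kappa> * (2 + \<delta>) / (2 * \<beta>) = (\<gamma> - 1) * (2 + \<delta>) / (2 * \<beta>) - \<eta> * (2 + \<delta>) / (2 * \<beta>)"
      by (simp add: \<kappa>_def left_diff_distrib diff_divide_distrib)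
    also have "\<eta> * (2 + \<delta>) / (2 * \<beta>) = g" using \<beta> \<delta> by (simp add: \<eta>_def)
    finally have "\<kappa> * (2 + \<delta>) / (2 * \<beta>) = 1 + \<theta> - \<delta> / 2" by (simp add: g_def)
    then have "\<kappa> * (2 + \<delta>) / (2 * \<beta>) * (2 / \<delta>) = (1 + \<theta> - \<delta> / 2) * (2 / \<delta>)" by simp
    moreover have "\<kappa> * (2 + \<delta>) / (2 * \<beta>) * (2 / \<delta>) = \<kappa> * (1 + \<alpha>)"
      using \<beta> \<delta> by (simp add: \<alpha>_eq field_simps)
    moreover have "(1 + \<theta> - \<delta> / 2) * (2 / \<delta>) = 2 * b - 1"
      using \<delta> by (simp add: b_def field_simps)
    ultimately show ?thesis by simp
  qed
  then have L_exp: "\<kappa> * (1 - \<alpha>) + 2 * b - 2 * \<gamma> = - 1 - 2 * \<eta>"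
    by (simp add: \<kappa>_def algebra_simps)
  \<comment> \<open>The two factors pay for replacing \<open>n + 3\<close> by \<open>2 * n\<close>
    and \<open>ln (n + 3)\<close> by \<open>2 * ln n\<close> in \<open>1 / width n\<close>.\<close>
  define c where "c = 2 powr a * 2 powr b"
  define C1 where "C1 = 18 * D * c\<^sup>2 / (\<alpha> - 1)"
  define E where "E n = (\<Sum>i<n. expectation (smooth_hit i))" for n
  have C1: "0 \<le> C1" using D \<alpha> by (simp add: C1_def)
  have "\<forall>\<^sub>F n in sequentially. prob {x \<in> space M. e * E n < \<bar>(\<Sum>i<n. smooth_hit i x) - E n\<bar>}
      \<le> (6 + C1) / e\<^sup>2 * ln (real n) powr (- (1 + \<eta>))" if e: "0 < e" for e
  proof -
    have "\<forall>\<^sub>F n in sequentially. 1 \<le> real n powr \<beta> * ln (real n) powr \<kappa>" using \<beta> by real_asymp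
    moreover have "\<forall>\<^sub>F n in sequentially. 1 \<le> ln (real n)" by real_asymp
    moreover have "\<forall>\<^sub>F n in sequentially. ln (real n + 3) \<le> 2 * ln (real n)" by real_asymp
    ultimately show ?thesis using E eventually_ge_at_top[of 3]
    proof eventually_elim
      case (elim n)
      define L where "L = ln (real n)"
      define y where "y = real n powr \<beta> * L powr \<kappa>"
      \<comment> \<open>Since \<open>y \<ge> 1\<close>, rounding up at most doubles
        \<open>y\<close>, so \<open>2 * N + 1 \<le> 6 * y\<close>.\<close>
      define N where "N = nat \<lceil>y\<rceil>"
      define z where "z = real n powr \<beta> * L powr \<gamma>"
      have L: "1 \<le> L" and y: "1 \<le> y" and E_ge: "z \<le> E n" and n: "3 \<le> real n"
        using elim by (auto simp: L_def y_def z_def E_def)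
      have z: "0 < z" using L n by (simp add: z_def)
      have En: "0 < E n" using z E_ge by linarith
      have N: "1 \<le> N" "y \<le> real N" "real N \<le> 2 * y" using y by (auto simp: N_def) linarith+
      have short: "(2 * real N + 1) * E n / (E n)\<^sup>2 \<le> 6 * L powr (- (1 + \<eta>))"
      proof -
        have "(2 * real N + 1) * E n / (E n)\<^sup>2 = (2 * real N + 1) / E n"
          using En by (simp add: power2_eq_square)
        also have "\<dots> \<le> 6 * y / z"
          using N y z E_ge by (intro frac_le) auto
        also have "\<dots> = 6 * (L powr \<kappa> / L powr \<gamma>)"
          using n by (simp add: y_def z_def)
        also have "L powr \<kappa> / L powr \<gamma> = L powr (- (1 + \<eta>))"
          by (simp add: powr_diff[symmetric] \<kappa>_def algebra_simps)
        finally show ?thesis .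
      qed
      have width: "1 / width n \<le> c * (real n powr a * L powr b)"
      proof -
        have "1 / width n = (real n + 3) powr a * ln (real n + 3) powr b"
          by (simp add: width_def a_def b_def powr_minus field_simps)
        also have "\<dots> \<le> (2 * real n) powr a * (2 * L) powr b"
          using n elim \<delta> \<theta> ln_ge_1[of n] by (intro mult_mono powr_mono2) (auto simp: a_def b_def L_def)
        also have "\<dots> = c * (real n powr a * L powr b)"
          using n L by (simp add: powr_mult c_def)
        finally show ?thesis .
      qed
      have long: "real n * (2 * (9 * D / (width n)\<^sup>2) * (real N powr (1 - \<alpha>) / (\<alpha> - 1))) / (E n)\<^sup>2
        \<le> C1 * L powr (- (1 + \<eta>))"
      proof -
        have "real n * (2 * (9 * D / (width n)\<^sup>2) * (real N powr (1 - \<alpha>) / (\<alpha> - 1))) / (E n)\<^sup>2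
          = 18 * D / (\<alpha> - 1) * (real n * real N powr (1 - \<alpha>) * (1 / width n)\<^sup>2 / (E n)\<^sup>2)"
          by (simp add: field_simps)
        \<comment> \<open>The exponent \<open>1 - \<alpha>\<close> is negative, so the lower bound
          \<open>y\<close> for \<open>N\<close> bounds the tail from above, as \<open>z\<close> does
          for the reciprocal of the mean.\<close>
        also have "\<dots> \<le> 18 * D / (\<alpha> - 1) * (real n * y powr (1 - \<alpha>) * (c * (real n powr a * L powr b))\<^sup>2 / z\<^sup>2)"
        proof (intro mult_left_mono frac_le mult_mono power_mono width E_ge powr_mono2')
          show "0 < z\<^sup>2" using z by simp
        qed (use N y z \<alpha> D width_pos[of n] in auto)
        also have "\<dots> = C1 * (real n * y powr (1 - \<alpha>) * (real n powr a * L powr b)\<^sup>2 / z\<^sup>2)"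
          by (simp add: C1_def power_mult_distrib)
        also have "real n * y powr (1 - \<alpha>) * (real n powr a * L powr b)\<^sup>2 / z\<^sup>2 = L powr (- 1 - 2 * \<eta>)"
          using powr_balance[of "real n" L \<beta> \<kappa> \<alpha> a b \<gamma>] n L by (simp add: n_exp L_exp y_def z_def)
        also have "C1 * \<dots> \<le> C1 * L powr (- (1 + \<eta>))"
          using L \<eta> C1 by (intro mult_left_mono powr_mono) auto
        finally show ?thesis .
      qed
      have "prob {x \<in> space M. e * E n < \<bar>(\<Sum>i<n. smooth_hit i x) - E n\<bar>}
        \<le> ((2 * real N + 1) * E n + real n * (2 * (9 * D / (width n)\<^sup>2) * (real N powr (1 - \<alpha>) / (\<alpha> - 1)))) / (e * E n)\<^sup>2"
        using prob_smooth_deviation_le[OF N(1), of "e * E n" n] e En by (simp add: E_def)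
      also have "\<dots> = ((2 * real N + 1) * E n / (E n)\<^sup>2
           + real n * (2 * (9 * D / (width n)\<^sup>2) * (real N powr (1 - \<alpha>) / (\<alpha> - 1))) / (E n)\<^sup>2) / e\<^sup>2"
        by (simp add: power_mult_distrib add_divide_distrib mult.commute)
      also have "\<dots> \<le> (6 * L powr (- (1 + \<eta>)) + C1 * L powr (- (1 + \<eta>))) / e\<^sup>2"
        using short long by (intro divide_right_mono add_mono) auto
      also have "\<dots> = (6 + C1) / e\<^sup>2 * L powr (- (1 + \<eta>))" by (simp add: algebra_simps)
      finally show ?case by (simp add: L_def)
    qed
  qed
  then show ?thesis using \<eta> unfolding E_def by blast
qed

text \<open>The smoothed count \<open>S\<close> is asymptotic to its mean \<open>F\<close>. The true
  count \<open>H\<close> differs from \<open>S\<close> by the finitely many near misses of the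
  orbit, and \<open>F\<close> differs from \<open>E\<close> by a bounded amount; both differences
  vanish after division.\<close>

lemma (in thickened_targets) AE_hit_ratio_tendsto_1:
  assumes \<beta>: "0 < \<beta>"
    and \<alpha>_eq: "\<alpha> = (2 / \<delta> + 1) / \<beta> - 1"
    and \<theta>_less: "\<theta> < (\<gamma> - 1) * (2 + \<delta>) / (2 * \<beta>) + \<delta> / 2 - 1"
    and E_ge: "\<forall>\<^sub>F n in sequentially. real n powr \<beta> * ln (real n) powr \<gamma> \<le> (\<Sum>i<n. prob (hit i))"
  shows "AE x in M. (\<lambda>n. (\<Sum>i<n. indicator (hit i) x) / (\<Sum>i<n. prob (hit i))) \<longlonglongrightarrow> 1"
proof -
  define S where "S n x = (\<Sum>i<n. smooth_hit i x)" for n x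
  define F where "F n = (\<Sum>i<n. expectation (smooth_hit i))" for n
  define H where "H n x = (\<Sum>i<n. indicat_real (hit i) x)" for n x
  define E where "E n = (\<Sum>i<n. prob (hit i))" for n
  have E_le_F: "E n \<le> F n" for n
    unfolding E_def F_def by (intro sum_mono expectation_smooth_hit_ge)
  obtain c where c: "\<And>n. F n \<le> E n + c"
    using sum_expectation_smooth_hit_le unfolding E_def F_def by blast
  have E_lim: "filterlim E at_top sequentially"
    using filterlim_at_top_of_powr_ln_le[OF E_ge \<beta>] by (simp add: E_def[abs_def])
  have F_lim: "filterlim F at_top sequentially"
    by (rule filterlim_at_top_mono[OF E_lim]) (use E_le_F in auto)
  have F_ge: "\<forall>\<^sub>F n in sequentially. real n powr \<beta> * ln (real n) powr \<gamma> \<le> F n"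
    using E_ge by eventually_elim (use E_le_F in \<open>auto simp: E_def intro: order_trans\<close>)
  have "(\<lambda>n. 1 + (F n - E n) / E n) \<longlonglongrightarrow> 1 + 0"
    by (intro tendsto_add tendsto_const tendsto_bounded_divide_at_top[OF _ E_lim, of _ c])
       (use c E_le_F in \<open>auto simp: algebra_simps\<close>)
  moreover have "\<forall>\<^sub>F n in sequentially. 1 + (F n - E n) / E n = F n / E n"
    using filterlim_at_top_dense[THEN iffD1, OF E_lim, rule_format, of 0]
    by eventually_elim (simp add: field_simps)
  ultimately have F_E: "(\<lambda>n. F n / E n) \<longlonglongrightarrow> 1"
    by (simp add: tendsto_cong)
  obtain \<eta> where "0 < \<eta>" and dev: "\<And>e. 0 < e \<Longrightarrow> \<exists>C. \<forall>\<^sub>F n in sequentially.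
      prob {x \<in> space M. e * F n < \<bar>S n x - F n\<bar>} \<le> C * ln (real n) powr (- (1 + \<eta>))"
    using prob_relative_deviation_le[OF \<beta> \<alpha>_eq \<theta>_less] F_ge unfolding F_def S_def by blast
  have "AE x in M. (\<lambda>n. S n x / F n) \<longlonglongrightarrow> 1"
    unfolding S_def F_def
    by (rule AE_sum_ratio_tendsto_1[OF _ smooth_hit_nonneg smooth_hit_le_1 _ \<open>0 < \<eta>\<close>])
       (use F_lim[unfolded F_def[abs_def]] dev[unfolded F_def S_def] in auto)
  then show ?thesis
    using AE_finitely_many_near_misses
  proof eventually_elim
    case (elim x)
    obtain m where m: "\<And>i. m \<le> i \<Longrightarrow> x \<notin> near_miss i"
      using elim(2) by (auto simp: eventually_sequentially)
    have "\<bar>H n x - S n x\<bar> \<le> real m" for n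
    proof -
      have "H n x \<le> S n x" unfolding H_def S_def by (intro sum_mono indicator_hit_le)
      moreover have "S n x \<le> H n x + real m" unfolding H_def S_def using m by (intro sum_smooth_hit_le)
      ultimately show ?thesis by simp
    qed
    then have "(\<lambda>n. (H n x - S n x) / F n) \<longlonglongrightarrow> 0"
      by (rule tendsto_bounded_divide_at_top[OF _ F_lim])
    then have "(\<lambda>n. (S n x / F n + (H n x - S n x) / F n) * (F n / E n)) \<longlonglongrightarrow> (1 + 0) * 1"
      using elim(1) F_E by (intro tendsto_mult tendsto_add)
    moreover have "\<forall>\<^sub>F n in sequentially. (S n x / F n + (H n x - S n x) / F n) * (F n / E n) = H n x / E n"
      using filterlim_at_top_dense[THEN iffD1, OF F_lim, rule_format, of 0]
      by eventually_elim (simp add: add_divide_distrib[symmetric])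
    ultimately have "(\<lambda>n. H n x / E n) \<longlonglongrightarrow> (1 + 0) * 1" by (rule Lim_transform_eventually)
    then show ?case by (simp add: H_def E_def)
  qed
qed

text \<open>Discard the orbits with a near miss after time \<open>m\<close>, about
  \<open>n powr (\<beta> / 2)\<close>. This \<open>m\<close> is negligible beside the mean, while
  \<open>ln m\<close> is still about \<open>\<beta> / 2 * ln n\<close>; hence the factor
  \<open>(\<beta> / 2) powr (- \<theta>)\<close>. The coefficient of the last term involves neither
  \<epsilon> nor \<rho>.\<close>

lemma (in thickened_targets) prob_hit_ratio_deviation_le:
  assumes \<beta>: "0 < \<beta>"
    and \<alpha>_eq: "\<alpha> = (2 / \<delta> + 1) / \<beta> - 1"
    and \<theta>_less: "\<theta> < (\<gamma> - 1) * (2 + \<delta>) / (2 * \<beta>) + \<delta> / 2 - 1"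
    and E_ge: "\<forall>\<^sub>F n in sequentially. real n powr \<beta> * ln (real n) powr \<gamma> \<le> (\<Sum>i<n. prob (hit i))"
    and \<epsilon>: "0 < \<epsilon>"
  shows "\<exists>C>0. \<forall>\<^sub>F n in sequentially.
    prob {x \<in> space M. \<epsilon> < \<bar>(\<Sum>i<n. indicator (hit i) x) / (\<Sum>i<n. prob (hit i)) - 1\<bar>}
      \<le> C * inverse (ln (real n)) * ln (ln (real n)) powr (- \<rho>)
        + (K / \<theta> * (\<beta> / 2) powr (- \<theta>) + 1) * ln (real n) powr (- \<theta>)"
proof -
  define S where "S n x = (\<Sum>i<n. smooth_hit i x)" for n x
  define F where "F n = (\<Sum>i<n. expectation (smooth_hit i))" for n
  define H where "H n x = (\<Sum>i<n. indicat_real (hit i) x)" for n x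
  define E where "E n = (\<Sum>i<n. prob (hit i))" for n
  have [measurable]: "S n \<in> borel_measurable M" for n
    unfolding S_def by measurable
  have E_le_F: "E n \<le> F n" for n
    unfolding E_def F_def by (intro sum_mono expectation_smooth_hit_ge)
  obtain c where c: "\<And>n. F n \<le> E n + c"
    using sum_expectation_smooth_hit_le unfolding E_def F_def by blast
  have E_lim: "filterlim E at_top sequentially"
    using filterlim_at_top_of_powr_ln_le[OF E_ge \<beta>] by (simp add: E_def[abs_def])
  have F_ge: "\<forall>\<^sub>F n in sequentially. real n powr \<beta> * ln (real n) powr \<gamma> \<le> F n"
    using E_ge by eventually_elim (use E_le_F in \<open>auto simp: E_def intro: order_trans\<close>)
  obtain \<eta> where "0 < \<eta>" and dev: "\<And>e. 0 < e \<Longrightarrow> \<exists>C. \<forall>\<^sub>F n in sequentially.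
      prob {x \<in> space M. e * F n < \<bar>S n x - F n\<bar>} \<le> C * ln (real n) powr (- (1 + \<eta>))"
    using prob_relative_deviation_le[OF \<beta> \<alpha>_eq \<theta>_less] F_ge unfolding F_def S_def by blast
  \<comment> \<open>Half of \<epsilon> is spent on the differences \<open>S - H\<close> and
    \<open>F - E\<close>; the remaining \<open>\<epsilon> / 2 * E n\<close> is at least
    \<open>\<epsilon> / 4 * F n\<close> once \<open>c < E n\<close>, since then
    \<open>F n \<le> 2 * E n\<close>.\<close>
  obtain C where C: "\<forall>\<^sub>F n in sequentially.
      prob {x \<in> space M. \<epsilon> / 4 * F n < \<bar>S n x - F n\<bar>} \<le> C * ln (real n) powr (- (1 + \<eta>))"
    using dev[of "\<epsilon> / 4"] \<epsilon> by auto
  have "\<forall>\<^sub>F n in sequentially. real n powr (\<beta> / 2) + c \<le> \<epsilon> / 2 * (real n powr \<beta> * ln (real n) powr \<gamma>)"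
    using \<beta> \<epsilon> by real_asymp
  moreover have "\<forall>\<^sub>F n in sequentially. real i0 + 1 \<le> real n powr (\<beta> / 2)" using \<beta> by real_asymp
  moreover have "\<forall>\<^sub>F n in sequentially. 1 < ln (real n)" by real_asymp
  \<comment> \<open>The extra power \<eta> of \<open>ln n\<close> beats every power of
    \<open>ln (ln n)\<close>, whatever \<rho> is.\<close>
  moreover have "\<forall>\<^sub>F n in sequentially.
      ln (real n) powr (- (1 + \<eta>)) \<le> inverse (ln (real n)) * ln (ln (real n)) powr (- \<rho>)"
    using \<open>0 < \<eta>\<close> by real_asymp
  moreover have "\<forall>\<^sub>F n in sequentially. max 1 c < E n"
    using filterlim_at_top_dense[THEN iffD1, OF E_lim] by blast
  ultimately have "\<forall>\<^sub>F n in sequentially. prob {x \<in> space M. \<epsilon> < \<bar>H n x / E n - 1\<bar>}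
      \<le> (\<bar>C\<bar> + 1) * inverse (ln (real n)) * ln (ln (real n)) powr (- \<rho>)
        + (K / \<theta> * (\<beta> / 2) powr (- \<theta>) + 1) * ln (real n) powr (- \<theta>)"
    using C E_ge eventually_gt_at_top[of 0]
  proof eventually_elim
    case (elim n)
    define m where "m = nat \<lfloor>real n powr (\<beta> / 2)\<rfloor>"
    have m: "i0 \<le> m" "real m \<le> real n powr (\<beta> / 2)" "real n powr (\<beta> / 2) \<le> real m + 1"
      using elim(2) by (auto simp: m_def le_nat_floor)
    have mc: "real m + c \<le> \<epsilon> / 2 * E n"
    proof -
      have "\<epsilon> / 2 * (real n powr \<beta> * ln (real n) powr \<gamma>) \<le> \<epsilon> / 2 * E n"
        using elim \<epsilon> by (intro mult_left_mono) (auto simp: E_def)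
      then show ?thesis using elim(1) m by linarith
    qed
    have "{x \<in> space M. \<epsilon> < \<bar>H n x / E n - 1\<bar>}
        \<subseteq> {x \<in> space M. \<epsilon> / 4 * F n < \<bar>S n x - F n\<bar>} \<union> (\<Union>i\<in>{m..<n}. near_miss i)" (is "_ \<subseteq> ?A \<union> ?B")
    proof
      fix x assume x: "x \<in> {x \<in> space M. \<epsilon> < \<bar>H n x / E n - 1\<bar>}"
      show "x \<in> ?A \<union> ?B"
      proof (cases "x \<in> ?B")
        case False
        have "H n x / E n - 1 = (H n x - E n) / E n" using elim by (simp add: field_simps)
        then have "\<epsilon> * E n < \<bar>H n x - E n\<bar>" using x elim by (simp add: field_simps)
        moreover have "H n x \<le> S n x" unfolding H_def S_def by (intro sum_mono indicator_hit_le)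
        moreover have "S n x \<le> H n x + real m"
          unfolding H_def S_def using False by (intro sum_smooth_hit_le) auto
        \<comment> \<open>Here \<open>S - H\<close> lies between 0 and \<open>m\<close>, and
          \<open>F - E\<close> between 0 and \<open>c\<close>, so at most
          \<open>m + c \<le> \<epsilon> / 2 * E n\<close> is lost.\<close>
        ultimately have "\<epsilon> / 2 * E n < \<bar>S n x - F n\<bar>"
          using mc E_le_F[of n] c[of n] by linarith
        moreover have "\<epsilon> / 4 * F n \<le> \<epsilon> / 4 * (2 * E n)"
          using c[of n] elim \<epsilon> by (intro mult_left_mono) auto
        ultimately show ?thesis using x by simp
      qed simp
    qed
    then have "prob {x \<in> space M. \<epsilon> < \<bar>H n x / E n - 1\<bar>} \<le> prob (?A \<union> ?B)"
      by (intro finite_measure_mono) auto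
    also have "\<dots> \<le> prob ?A + prob ?B" by (intro measure_Un_le) auto
    also have "prob ?B \<le> (\<Sum>i=m..<n. prob (near_miss i))"
      by (intro finite_measure_subadditive_finite) auto
    also have "\<dots> \<le> K / \<theta> * ln (real m + 2) powr (- \<theta>)" using m by (intro sum_prob_near_miss_le)
    also have "\<dots> \<le> K / \<theta> * ((\<beta> / 2) powr (- \<theta>) * ln (real n) powr (- \<theta>))"
    proof -
      have pos: "0 < \<beta> / 2 * ln (real n)" using \<beta> elim(3) by (intro mult_pos_pos) linarith+
      have "\<beta> / 2 * ln (real n) = ln (real n powr (\<beta> / 2))" using elim by (simp add: ln_powr)
      also have "\<dots> \<le> ln (real m + 2)" using m elim by (subst ln_le_cancel_iff) auto
      finally have "ln (real m + 2) powr (- \<theta>) \<le> (\<beta> / 2 * ln (real n)) powr (- \<theta>)"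
        using \<theta> pos by (intro powr_mono2') simp_all
      also have "\<dots> = (\<beta> / 2) powr (- \<theta>) * ln (real n) powr (- \<theta>)"
        using \<beta> elim by (subst powr_mult) auto
      finally show ?thesis using K \<theta> by (intro mult_left_mono) auto
    qed
    also have "\<dots> \<le> (K / \<theta> * (\<beta> / 2) powr (- \<theta>) + 1) * ln (real n) powr (- \<theta>)"
      by (simp add: algebra_simps)
    also have "prob ?A \<le> (\<bar>C\<bar> + 1) * inverse (ln (real n)) * ln (ln (real n)) powr (- \<rho>)"
    proof -
      have "prob ?A \<le> C * ln (real n) powr (- (1 + \<eta>))" using elim by simp
      also have "\<dots> \<le> (\<bar>C\<bar> + 1) * ln (real n) powr (- (1 + \<eta>))" by (intro mult_right_mono) auto
      also have "\<dots> \<le> (\<bar>C\<bar> + 1) * (inverse (ln (real n)) * ln (ln (real n)) powr (- \<rho>))"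
        using elim by (intro mult_left_mono) auto
      finally show ?thesis by (simp add: mult.assoc)
    qed
    finally show ?case by simp
  qed
  then show ?thesis unfolding H_def E_def by (intro exI[of _ "\<bar>C\<bar> + 1"]) auto
qed

section \<open>Balls under condition (A) and polynomial decay of correlations\<close>

theorem theorem4:
  fixes M :: "'a::metric_space measure"
    and T :: "'a \<Rightarrow> 'a"
    and \<delta> \<beta> \<gamma> r0 :: real
    and p :: "nat \<Rightarrow> 'a"
    and r :: "nat \<Rightarrow> real"
    and B :: "nat \<Rightarrow> 'a set"
  assumes "prob_space M"
    and "sets M = sets borel"
    and "preserves_measure M T"
    and "0 < \<delta>" and "\<delta> < 2"
    and "\<And>i. r i > 0"
    and "\<And>i. B i = ball (p i) (r i)"
    and "condition_A M \<delta> r0 UNIV \<or>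
         (\<exists>q. (\<forall>i. p i = q) \<and> decseq B \<and> r \<longlonglongrightarrow> 0 \<and> condition_A M \<delta> r0 {q})"
    and "\<forall>\<^sub>F i in sequentially. r i \<le> r0"
    and "0 < \<beta>" and "\<beta> < 1"
    and "\<gamma> > 1 + (2 - \<delta>) * \<beta> / (2 + \<delta>)"
    and "\<forall>\<^sub>F n in sequentially.
           (\<Sum>i<n. measure M (B i)) \<ge> real n powr \<beta> * ln (real n) powr \<gamma>"
    and "polynomial_decay M T ((2 / \<delta> + 1) / \<beta> - 1)"
  shows "(AE x in M. (\<lambda>n. hit_ratio M T B n x) \<longlonglongrightarrow> 1) \<and>
         (\<forall>\<theta>. 0 < \<theta> \<and> \<theta> < (\<gamma> - 1) * (2 + \<delta>) / (2 * \<beta>) + \<delta> / 2 - 1 \<longrightarrow>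
           (\<exists>C\<^sub>\<theta>>0. \<forall>\<epsilon> \<rho>. \<epsilon> > 0 \<and> \<rho> > 1 \<longrightarrow>
             (\<exists>C>0. \<forall>\<^sub>F n in sequentially.
                measure M {x \<in> space M. \<bar>hit_ratio M T B n x - 1\<bar> > \<epsilon>}
                  \<le> C * inverse (ln (real n)) * ln (ln (real n)) powr (- \<rho>)
                    + C\<^sub>\<theta> * ln (real n) powr (- \<theta>))))"
proof -
  interpret prob_space M by fact
  define \<alpha> where "\<alpha> = (2 / \<delta> + 1) / \<beta> - 1"
  define \<theta>max where "\<theta>max = (\<gamma> - 1) * (2 + \<delta>) / (2 * \<beta>) + \<delta> / 2 - 1"
  \<comment> \<open>From \<open>\<delta> < 2\<close> comes \<open>2 / \<delta> + 1 > 2\<close>, and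
    division by \<open>\<beta> < 1\<close> increases it. This makes the covariance tails
    summable.\<close>
  have \<alpha>: "1 < \<alpha>"
  proof -
    have "2 < 2 / \<delta> + 1" using assms(4,5) by (simp add: field_simps)
    moreover from this have "(2 / \<delta> + 1) * \<beta> < (2 / \<delta> + 1) * 1"
      using assms(11) by (intro mult_strict_left_mono) auto
    then have "2 / \<delta> + 1 < (2 / \<delta> + 1) / \<beta>" using assms(10) by (simp add: pos_less_divide_eq)
    ultimately show ?thesis by (simp add: \<alpha>_def)
  qed
  \<comment> \<open>The lower bound on \<gamma> says exactly that the range of admissible \<theta>
    is nonempty.\<close>
  have \<theta>max: "0 < \<theta>max"
  proof -
    have "(2 - \<delta>) * \<beta> / (2 + \<delta>) * ((2 + \<delta>) / (2 * \<beta>)) < (\<gamma> - 1) * ((2 + \<delta>) / (2 * \<beta>))"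
      using assms(4,10,12) by (intro mult_strict_right_mono) auto
    moreover have "(2 - \<delta>) * \<beta> / (2 + \<delta>) * ((2 + \<delta>) / (2 * \<beta>)) = (2 - \<delta>) / 2"
      using assms(4,10) by simp
    ultimately show ?thesis by (simp add: \<theta>max_def diff_divide_distrib)
  qed
  \<comment> \<open>\<open>S\<close> is \<open>UNIV\<close> in general and \<open>{q}\<close> for
    nested balls about \<open>q\<close>; either way one constant serves all centres
    \<open>p i\<close>.\<close>
  obtain S where S: "condition_A M \<delta> r0 S" "\<And>i. p i \<in> S"
    using assms(8) by (elim disjE exE conjE) auto
  then obtain K where K: "0 < K" and annulus: "\<And>i s e. 0 < s \<Longrightarrow> s \<le> r0 \<Longrightarrow> 0 < e \<Longrightarrow> e \<le> 1 \<Longrightarrow>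
      prob {x. s < dist x (p i) \<and> dist x (p i) < s + e} < K * e powr \<delta>"
    unfolding condition_A_def by blast
  obtain D c where D: "0 < D" and c: "\<And>n. 1 \<le> n \<Longrightarrow> c n \<le> D * real n powr (- \<alpha>)"
    and corr: "\<And>\<phi> \<psi> n. bounded_lipschitz \<phi> \<Longrightarrow> bounded_lipschitz \<psi> \<Longrightarrow> 1 \<le> n \<Longrightarrow>
      \<bar>expectation (\<lambda>x. \<phi> ((T ^^ n) x) * \<psi> x) - expectation \<phi> * expectation \<psi>\<bar> \<le> c n * lip_norm \<phi> * lip_norm \<psi>"
    using assms(14) unfolding polynomial_decay_def \<alpha>_def by blast
  obtain i0 where i0: "\<And>i. i0 \<le> i \<Longrightarrow> r i \<le> r0"
    using assms(9) by (auto simp: eventually_sequentially)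
  have thick: "thickened_targets M T p r r0 K D \<delta> \<theta> \<alpha> i0" if "0 < \<theta>" for \<theta>
  proof
    fix \<phi> \<psi> :: "'a \<Rightarrow> real" and n :: nat
    assume *: "bounded_lipschitz \<phi>" "bounded_lipschitz \<psi>" "1 \<le> n"
    have "c n * lip_norm \<phi> * lip_norm \<psi> \<le> D * real n powr (- \<alpha>) * lip_norm \<phi> * lip_norm \<psi>"
      using * c by (intro mult_right_mono lip_norm_nonneg) auto
    with corr[OF *] show "\<bar>expectation (\<lambda>x. \<phi> ((T ^^ n) x) * \<psi> x) - expectation \<phi> * expectation \<psi>\<bar>
        \<le> D * real n powr (- \<alpha>) * lip_norm \<phi> * lip_norm \<psi>"
      by linarith
  qed (use assms \<alpha> K D i0 annulus that in \<open>auto intro: less_imp_le\<close>)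
  \<comment> \<open>Almost sure convergence follows from any one admissible \<theta>; half the
    maximum is such a choice.\<close>
  interpret t0: thickened_targets M T p r r0 K D \<delta> "\<theta>max / 2" \<alpha> i0
    using thick \<theta>max by simp
  \<comment> \<open>The sets \<open>hit i\<close> do not involve \<theta>, so the facts derived here
    also serve the later interpretation with arbitrary \<theta>.\<close>
  have hit: "t0.hit i = {x \<in> space M. (T ^^ i) x \<in> B i}" for i
    by (simp add: t0.hit_def assms(7))
  have E: "(\<Sum>i<n. prob (t0.hit i)) = (\<Sum>i<n. prob (B i))" for n
    by (simp add: t0.prob_hit assms(7))
  have ratio: "(\<Sum>i<n. indicator (t0.hit i) x) / (\<Sum>i<n. prob (t0.hit i)) = hit_ratio M T B n x" for n x
    unfolding hit_ratio_def E by (simp add: hit t0.space_M indicator_def)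
  have E_ge: "\<forall>\<^sub>F n in sequentially. real n powr \<beta> * ln (real n) powr \<gamma> \<le> (\<Sum>i<n. prob (t0.hit i))"
    using assms(13) unfolding E .
  have half: "\<theta>max / 2 < (\<gamma> - 1) * (2 + \<delta>) / (2 * \<beta>) + \<delta> / 2 - 1"
    unfolding \<theta>max_def[symmetric] using \<theta>max by simp
  have "AE x in M. (\<lambda>n. hit_ratio M T B n x) \<longlonglongrightarrow> 1"
    using t0.AE_hit_ratio_tendsto_1[OF assms(10) \<alpha>_def half E_ge] unfolding ratio .
  moreover have "\<exists>C\<^sub>\<theta>>0. \<forall>\<epsilon> \<rho>. \<epsilon> > 0 \<and> \<rho> > 1 \<longrightarrow>
             (\<exists>C>0. \<forall>\<^sub>F n in sequentially.
                measure M {x \<in> space M. \<bar>hit_ratio M T B n x - 1\<bar> > \<epsilon>}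
                  \<le> C * inverse (ln (real n)) * ln (ln (real n)) powr (- \<rho>)
                    + C\<^sub>\<theta> * ln (real n) powr (- \<theta>))"
    if \<theta>: "0 < \<theta>" "\<theta> < \<theta>max" for \<theta>
  proof -
    interpret t: thickened_targets M T p r r0 K D \<delta> \<theta> \<alpha> i0 by (rule thick) fact
    have pos: "0 < K / \<theta> * (\<beta> / 2) powr (- \<theta>) + 1"
      using K \<theta> by (intro add_nonneg_pos) auto
    show ?thesis
    proof (rule exI[of _ "K / \<theta> * (\<beta> / 2) powr (- \<theta>) + 1"], intro conjI allI impI pos)
      fix \<epsilon> \<rho> :: real
      assume "\<epsilon> > 0 \<and> \<rho> > 1"
      then show "\<exists>C>0. \<forall>\<^sub>F n in sequentially.
          prob {x \<in> space M. \<bar>hit_ratio M T B n x - 1\<bar> > \<epsilon>}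
            \<le> C * inverse (ln (real n)) * ln (ln (real n)) powr (- \<rho>)
              + (K / \<theta> * (\<beta> / 2) powr (- \<theta>) + 1) * ln (real n) powr (- \<theta>)"
        using t.prob_hit_ratio_deviation_le[OF assms(10) \<alpha>_def \<theta>(2)[unfolded \<theta>max_def] E_ge, of \<epsilon> \<rho>]
        unfolding ratio by simp
    qed
  qed
  ultimately show ?thesis unfolding \<theta>max_def by blast
qed

end
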